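(* Let $M$ be a totally ordered, positive, bounded factorization monoid that is bounded away from $0$. Suppose that the difference group $\Gamma := \mathsf{gp}(M)$ has no minimal strictly positive element. Let $k$ be a field, let $D = k[t;M]_{(t;M)}$, and let $K$ be the field of fractions of $D$. Then $\operatorname{Int}^{\mathrm R}(K,D)$ is a local, atomic domain.
   Context: Rings are commutative with identity; monoids are commutative, cancellative and written additively here. "Local" means having a unique maximal ideal (no Noetherian assumption). For a domain $D$ with field of fractions $K$, $\operatorname{Int}^{\mathrm R}(K,D) = \{\varphi \in K(x) \mid \varphi(a) \in D \text{ for all } a \in K\}$ (in particular $\varphi$ is defined at every $a\in K$). An atom is an irreducible element. A domain (or monoid) is atomic if every nonzero nonunit (for an additive monoid: every nonunit) is a finite product (sum) of atoms. A domain or monoid is of bounded factorization if it is atomic and, for each (nonzero) nonunit, the set of lengths (numbers of atoms, counted with multiplicity) of its factorizations into atoms is finite. A monoid $M$ is totally ordered if it carries a total order $\le$ such that $\alpha\le\alpha'$ and $\beta\le\beta'$ imply $\alpha+\beta\le\alpha'+\beta'$. It is positive if $\alpha\ge 0$ for all $\alpha\in M$. Its difference group is $\mathsf{gp}(M)=\{\alpha-\alpha'\mid \alpha,\alpha'\in M\}$, with the induced total order. $M$ is bounded away from $0$ if there is $\gamma\in\mathsf{gp}(M)$ with $\gamma>0$ such that $\alpha\ge\gamma$ for every nonzero $\alpha\in M$. $k[t;M]$ is the monoid ring, whose elements are finite sums of terms $r t^\alpha$ ($r\in k$, $\alpha\in M$) with $t^{\alpha}t^{\beta}=t^{\alpha+\beta}$.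 $(t;M)$ is the ideal generated by $\{t^\alpha\mid \alpha \text{ a nonzero nonunit of } M\}$ (here: all $\alpha \in M\setminus\{0\}$), and $k[t;M]_{(t;M)}$ is the localization at this prime ideal. *)

theory Defs
  imports
    "HOL-Library.Poly_Mapping"
    "HOL-Computational_Algebra.Polynomial"
    "HOL-Computational_Algebra.Fraction_Field"
    "HOL-Algebra.Algebraic_Closure_Type"
begin

section \<open>The difference group of a totally ordered cancellative monoid\<close>

definition diff_rel :: "'m \<times> 'm \<Rightarrow> 'm \<times> 'm::{cancel_ab_semigroup_add, comm_monoid_add} \<Rightarrow> bool" where
  "diff_rel x y \<longleftrightarrow> fst x + snd y = fst y + snd x"

lemma equivp_diff_rel:
  "equivp (diff_rel :: 'm \<times> 'm \<Rightarrow> 'm \<times> 'm::{cancel_ab_semigroup_add, comm_monoid_add} \<Rightarrow> bool)"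
proof (rule equivpI)
  show "transp (diff_rel :: 'm \<times> 'm \<Rightarrow> 'm \<times> 'm \<Rightarrow> bool)"
  proof (rule transpI)
    fix x y z :: "'m \<times> 'm"
    assume "diff_rel x y" "diff_rel y z"
    then have "(fst x + snd z) + (fst y + snd y) = (fst z + snd x) + (fst y + snd y)"
      unfolding diff_rel_def by (metis (no_types, opaque_lifting) add.assoc add.commute)
    then show "diff_rel x z"
      unfolding diff_rel_def by (simp only: add_right_cancel)
  qed
qed (auto simp: reflp_def symp_def diff_rel_def)

text \<open>The class \<open>(a, b)\<close> stands for the formal difference \<open>a - b\<close>.\<close>

quotient_type (overloaded) 'm gp = "'m::{cancel_ab_semigroup_add, comm_monoid_add} \<times> 'm" / diff_rel
  by (rule equivp_diff_rel)

lift_definition gp_of :: "'m::{cancel_ab_semigroup_add, comm_monoid_add} \<Rightarrow> 'm gp" is "\<lambda>a. (a, 0)" .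

instantiation gp :: ("{cancel_ab_semigroup_add, comm_monoid_add}") ab_group_add
begin

lift_definition zero_gp :: "'a gp" is "(0, 0)" .

lift_definition plus_gp :: "'a gp \<Rightarrow> 'a gp \<Rightarrow> 'a gp"
  is "\<lambda>x y. (fst x + fst y, snd x + snd y)"
proof -
  fix x x' y y' :: "'a \<times> 'a"
  assume "diff_rel x x'" "diff_rel y y'"
  then have "(fst x + snd x') + (fst y + snd y') = (fst x' + snd x) + (fst y' + snd y)"
    by (simp only: diff_rel_def)
  then show "diff_rel (fst x + fst y, snd x + snd y) (fst x' + fst y', snd x' + snd y')"
    by (simp add: diff_rel_def ac_simps)
qed

lift_definition uminus_gp :: "'a gp \<Rightarrow> 'a gp" is "\<lambda>x. (snd x, fst x)"
  unfolding diff_rel_def fst_conv snd_conv by (simp add: add.commute)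

definition minus_gp :: "'a gp \<Rightarrow> 'a gp \<Rightarrow> 'a gp" where
  "minus_gp x y = x + - y"

instance
  by intro_classes (simp_all only: minus_gp_def, (transfer, simp add: diff_rel_def ac_simps)+)

end

lemma add_le_cancel_right_linorder:
  fixes a b c :: "'a::{ordered_cancel_comm_monoid_add, linorder}"
  shows "a + c \<le> b + c \<longleftrightarrow> a \<le> b"
  using add_right_mono[of a b c] add_strict_right_mono[of b a c] by (auto simp: not_le[symmetric])

lemma gp_le_aux:
  fixes a b c d a' b' c' d' :: "'a::{ordered_cancel_comm_monoid_add, linorder}"
  assumes "a + b' = a' + b" "c + d' = c' + d" "a + d \<le> c + b"
  shows "a' + d' \<le> c' + b'"
proof -
  have "(a + d) + (b' + d') \<le> (c + b) + (b' + d')"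
    using assms(3) by (rule add_right_mono)
  moreover have "(a + d) + (b' + d') = (a' + d') + (b + d)"
  proof -
    have "(a + d) + (b' + d') = (a + b') + (d + d')" by (simp add: ac_simps)
    also have "\<dots> = (a' + b) + (d + d')" by (simp only: assms(1))
    finally show ?thesis by (simp add: ac_simps)
  qed
  moreover have "(c + b) + (b' + d') = (c' + b') + (b + d)"
  proof -
    have "(c + b) + (b' + d') = (c + d') + (b + b')" by (simp add: ac_simps)
    also have "\<dots> = (c' + d) + (b + b')" by (simp only: assms(2))
    finally show ?thesis by (simp add: ac_simps)
  qed
  ultimately show ?thesis by (simp add: add_le_cancel_right_linorder)
qed

instantiation gp :: ("{ordered_cancel_comm_monoid_add, linorder}") linordered_ab_group_add
begin

lift_definition less_eq_gp :: "'a gp \<Rightarrow> 'a gp \<Rightarrow> bool"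
  is "\<lambda>x y. fst x + snd y \<le> fst y + snd x"
  unfolding diff_rel_def by (metis gp_le_aux)

definition less_gp :: "'a gp \<Rightarrow> 'a gp \<Rightarrow> bool" where
  "less_gp x y \<longleftrightarrow> x \<le> y \<and> \<not> y \<le> x"

instance
proof
  fix x y z :: "'a gp"
  show "x < y \<longleftrightarrow> x \<le> y \<and> \<not> y \<le> x" by (rule less_gp_def)
  show "x \<le> x" by transfer simp
  show "x \<le> y \<or> y \<le> x" by transfer (rule linear)
  show "x \<le> y \<Longrightarrow> y \<le> x \<Longrightarrow> x = y" by transfer (simp add: diff_rel_def)
  show "x \<le> y \<Longrightarrow> z + x \<le> z + y"
  proof transfer
    fix x y z :: "'a \<times> 'a"
    assume "fst x + snd y \<le> fst y + snd x"
    from add_left_mono[OF this, of "fst z + snd z"]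
    show "fst (fst z + fst x, snd z + snd x) + snd (fst z + fst y, snd z + snd y)
      \<le> fst (fst z + fst y, snd z + snd y) + snd (fst z + fst x, snd z + snd x)"
      by (simp add: ac_simps)
  qed
  show "x \<le> y \<Longrightarrow> y \<le> z \<Longrightarrow> x \<le> z"
  proof transfer
    fix x y z :: "'a \<times> 'a"
    assume "fst x + snd y \<le> fst y + snd x" "fst y + snd z \<le> fst z + snd y"
    from add_mono[OF this]
    have "(fst x + snd z) + (fst y + snd y) \<le> (fst z + snd x) + (fst y + snd y)"
      by (simp add: ac_simps)
    then show "fst x + snd z \<le> fst z + snd x" by (simp only: add_le_cancel_right_linorder)
  qed
qed

end

lemma gp_of_add: "gp_of (a + b) = gp_of a + gp_of b"
  by transfer (simp add: diff_rel_def)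

lemma gp_of_eq_iff: "gp_of a = gp_of b \<longleftrightarrow> a = b"
  by transfer (simp add: diff_rel_def)

lemma gp_of_le_iff:
  "gp_of a \<le> gp_of b \<longleftrightarrow> a \<le> (b :: 'm::{ordered_cancel_comm_monoid_add, linorder})"
  by transfer simp

lemma gp_is_difference: "\<exists>a b. x = gp_of a - gp_of b"
  unfolding minus_gp_def by transfer (auto simp: diff_rel_def add.commute)


section \<open>Conditions on monoids\<close>

definition additive_monoid :: "'m::comm_monoid_add monoid" where
  "additive_monoid = \<lparr>carrier = UNIV, monoid.mult = (+), one = 0\<rparr>"

definition atomic_monoid :: "('a, 'b) monoid_scheme \<Rightarrow> bool" where
  "atomic_monoid G \<longleftrightarrow>
     (\<forall>a \<in> carrier G - Units G. \<exists>fs. set fs \<subseteq> carrier G \<and> factors G fs a)"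

definition bounded_factorization_monoid :: "('a, 'b) monoid_scheme \<Rightarrow> bool" where
  "bounded_factorization_monoid G \<longleftrightarrow> atomic_monoid G \<and>
     (\<forall>a \<in> carrier G - Units G.
        finite {length fs | fs. set fs \<subseteq> carrier G \<and> factors G fs a})"

definition bounded_away_from_0 :: "'m::{ordered_cancel_comm_monoid_add, linorder} itself \<Rightarrow> bool" where
  "bounded_away_from_0 _ \<longleftrightarrow>
     (\<exists>\<gamma>::'m gp. \<gamma> > 0 \<and> (\<forall>\<alpha>::'m. \<alpha> \<noteq> 0 \<longrightarrow> gp_of \<alpha> \<ge> \<gamma>))"


section \<open>Conditions on rings\<close>

definition local_ring :: "('a, 'b) ring_scheme \<Rightarrow> bool" where
  "local_ring R \<longleftrightarrow> cring R \<and> (\<exists>!I. maximalideal I R)"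

definition atomic_domain :: "('a, 'b) ring_scheme \<Rightarrow> bool" where
  "atomic_domain R \<longleftrightarrow> domain R \<and> atomic_monoid (mult_of R)"

definition subring_of :: "'a::comm_ring_1 set \<Rightarrow> 'a ring" where
  "subring_of S = ring_of_type_algebra\<lparr>carrier := S\<rparr>"


section \<open>The monoid ring and its localization\<close>

text \<open>
  The monoid ring \<open>k[t;M]\<close> is the type \<open>'m \<Rightarrow>\<^sub>0 'k\<close> of finitely supported functions with the
  convolution product, \<open>t\<^sup>\<alpha>\<close> being \<open>Poly_Mapping.single \<alpha> 1\<close>.
\<close>

definition tM_ideal :: "('m::comm_monoid_add \<Rightarrow>\<^sub>0 'k::comm_ring_1) set" where
  "tM_ideal = Idl\<^bsub>ring_of_type_algebra\<^esub>
     {Poly_Mapping.single \<alpha> 1 | \<alpha>. \<alpha> \<noteq> 0 \<and> \<alpha> \<notin> Units additive_monoid}"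

text \<open>
  The localization is realised inside the field of fractions of \<open>k[t;M]\<close>. For a positive monoid
  this is also the field of fractions of the localization, see \<open>tM_localization_fractions\<close>.
\<close>

definition tM_localization ::
  "('m::{ordered_cancel_comm_monoid_add, linorder} \<Rightarrow>\<^sub>0 'k::field) fract set" where
  "tM_localization = {Fract f g | f g. g \<notin> tM_ideal}"

lemma lookup_mult_constant_coeff:
  fixes f g :: "'m::{ordered_cancel_comm_monoid_add, linorder} \<Rightarrow>\<^sub>0 'k::field"
  assumes pos: "\<forall>\<alpha>::'m. \<alpha> \<ge> 0" and f: "Poly_Mapping.lookup f 0 = 0"
  shows "Poly_Mapping.lookup (f * g) 0 = 0"
proof -
  have "Poly_Mapping.lookup f l * Sum_any (\<lambda>q. Poly_Mapping.lookup g q when 0 = l + q) = 0" for l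
  proof (cases "l = 0")
    case False
    then have "0 \<noteq> l + q" for q
      using pos add_nonneg_eq_0_iff[of l q] by metis
    then show ?thesis by simp
  qed (simp add: f)
  then show ?thesis by (simp only: lookup_mult Sum_any.neutral)
qed

lemma tM_ideal_constant_coeff:
  fixes f :: "'m::{ordered_cancel_comm_monoid_add, linorder} \<Rightarrow>\<^sub>0 'k::field"
  assumes pos: "\<forall>\<alpha>::'m. \<alpha> \<ge> 0" and f: "f \<in> tM_ideal"
  shows "Poly_Mapping.lookup f 0 = 0"
proof -
  let ?R = "ring_of_type_algebra :: ('m \<Rightarrow>\<^sub>0 'k) ring"
  let ?I = "{f :: 'm \<Rightarrow>\<^sub>0 'k. Poly_Mapping.lookup f 0 = 0}"
  interpret R: cring ?R by (rule cring_from_type_algebra)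
  have "ideal ?I ?R"
  proof (rule idealI)
    show "subgroup ?I (add_monoid ?R)"
    proof (rule R.add.subgroupI)
      fix a assume a: "a \<in> ?I"
      have "\<ominus>\<^bsub>?R\<^esub> a = - a"
        by (rule R.minus_equality) (simp_all add: ring_of_type_algebra_def)
      with a show "\<ominus>\<^bsub>?R\<^esub> a \<in> ?I" by simp
    next
      have "(0 :: 'm \<Rightarrow>\<^sub>0 'k) \<in> ?I" by simp
      then show "?I \<noteq> {}" by blast
    qed (auto simp: ring_of_type_algebra_def lookup_add)
  next
    fix a x :: "'m \<Rightarrow>\<^sub>0 'k"
    assume "a \<in> ?I"
    then have "Poly_Mapping.lookup (a * x) 0 = 0"
      using lookup_mult_constant_coeff[OF pos] by blast
    then show "a \<otimes>\<^bsub>?R\<^esub> x \<in> ?I" "x \<otimes>\<^bsub>?R\<^esub> a \<in> ?I"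
      by (simp_all add: ring_of_type_algebra_def mult.commute)
  qed (rule R.ring_axioms)
  moreover have "{Poly_Mapping.single \<alpha> 1 | \<alpha>. \<alpha> \<noteq> 0 \<and> \<alpha> \<notin> Units additive_monoid} \<subseteq> ?I"
    by (auto simp: lookup_single when_def)
  ultimately have "tM_ideal \<subseteq> ?I"
    unfolding tM_ideal_def by (rule R.genideal_minimal)
  with f show ?thesis by auto
qed

lemma tM_localization_fractions:
  fixes z :: "('m::{ordered_cancel_comm_monoid_add, linorder} \<Rightarrow>\<^sub>0 'k::field) fract"
  assumes pos: "\<forall>\<alpha>::'m. \<alpha> \<ge> 0"
  shows "\<exists>a \<in> tM_localization. \<exists>b \<in> tM_localization. b \<noteq> 0 \<and> z = a / b"
proof -
  have one: "(1 :: 'm \<Rightarrow>\<^sub>0 'k) \<notin> tM_ideal"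
    using tM_ideal_constant_coeff[OF pos, of "1 :: 'm \<Rightarrow>\<^sub>0 'k"] by (auto simp: lookup_one)
  obtain f g where z: "z = Fract f g" "g \<noteq> 0" by (cases z)
  have "Fract f 1 \<in> tM_localization" "Fract g 1 \<in> tM_localization"
    using one unfolding tM_localization_def by blast+
  moreover have "Fract g 1 \<noteq> 0" "z = Fract f 1 / Fract g 1"
    using z by (simp_all add: Zero_fract_def eq_fract)
  ultimately show ?thesis by blast
qed


section \<open>Rings of integer-valued rational functions\<close>

text \<open>
  \<open>has_value \<phi> a b\<close>: the rational function \<open>\<phi>\<close> is defined at \<open>a\<close>, and \<open>\<phi>(a) = b\<close>.
\<close>

definition has_value :: "'a::field poly fract \<Rightarrow> 'a \<Rightarrow> 'a \<Rightarrow> bool" where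
  "has_value \<phi> a b \<longleftrightarrow>
     (\<exists>p q. \<phi> = Fract p q \<and> poly q a \<noteq> 0 \<and> b = poly p a / poly q a)"

lemma has_value_unique:
  assumes "has_value \<phi> a b" "has_value \<phi> a c"
  shows "b = c"
proof -
  obtain p q r s where *: "Fract p q = Fract r s" "poly q a \<noteq> 0" "poly s a \<noteq> 0"
    "b = poly p a / poly q a" "c = poly r a / poly s a"
    using assms unfolding has_value_def by metis
  then have "p * s = r * q" by (metis eq_fract(1) poly_0)
  then have "poly p a * poly s a = poly r a * poly q a" by (metis poly_mult)
  with * show ?thesis by (simp add: frac_eq_eq)
qed

text \<open>Here \<open>K\<close> is the whole type \<open>'a\<close>, so \<open>D\<close> is meant to be a subring with fraction field \<open>'a\<close>.\<close>

definition Int_R :: "'a::field set \<Rightarrow> 'a poly fract set" where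
  "Int_R D = {\<phi>. \<forall>a. \<exists>b \<in> D. has_value \<phi> a b}"

end

theory Submission
  imports Defs
begin

text \<open>
  Let \<open>v\<close> be the least-exponent valuation on \<open>K\<close>; it maps the nonzero elements of \<open>D\<close> to \<open>M\<close>, so no
  element of \<open>D\<close> has value strictly between \<open>0\<close> and \<open>\<gamma>\<close>. The heart of the matter is that the values
  of an integer-valued \<open>\<phi>\<close> are either all units or all nonunits of \<open>D\<close>. Then the \<open>\<phi>\<close> with \<open>\<phi>(0)\<close> a
  nonunit form the only maximal ideal, and the maximal length of a factorization of \<open>v(\<phi>(a))\<close> in
  \<open>M\<close> bounds the number of nonunit factors of \<open>\<phi>\<close>.

  If \<open>gp M\<close> has no proper nonzero convex subgroup, then for all but finitely many \<open>\<delta>\<close> the value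
  \<open>v(\<phi>(a + x))\<close> depends only on \<open>\<delta> = v(x)\<close>, through a difference of uniformly continuous
  functions. As \<open>gp M\<close> is dense and archimedean, small steps connect all \<open>\<delta>\<close>, and a step cannot jump
  over the gap between \<open>0\<close> and \<open>\<gamma>\<close>. For large \<open>\<delta>\<close> one sees \<open>\<phi>(a)\<close>, and for very negative \<open>\<delta>\<close> the
  point \<open>a\<close> does not matter.

  If there is a proper nonzero convex subgroup \<open>H\<close>, then \<open>\<phi>\<close> is constant: if not,
  \<open>\<phi>(x) - \<phi>(0) = x\<^sup>r \<psi>(x) \<in> D\<close> with \<open>r > 0\<close>, where \<open>\<psi>(x)\<close> has constant value as long as \<open>v(x)\<close> lies far
  enough above \<open>H\<close>. If \<open>H\<close> contains a nonzero \<open>\<sigma> \<in> M\<close>, dividing \<open>x\<close> by \<open>t\<^sup>\<sigma>\<close> again and again contradicts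
  bounded factorization. If \<open>M \<inter> H = 0\<close>, leading forms modulo \<open>H\<close> of elements of \<open>D\<close> are polynomial,
  which fails for \<open>x = t\<^sup>\<delta> / (t\<^sup>a + t\<^sup>b)\<close> with \<open>a - b \<in> H\<close> large.
\<close>

section \<open>Convex subgroups\<close>

text \<open>Such \<open>H\<close> are the kernels of order-preserving quotients, so each one gives a
  coarsening of the valuation. Convexity is asked only upwards from \<open>0\<close>; closure under
  negation supplies the rest.\<close>

definition convex_subgroup :: "'g::linordered_ab_group_add set \<Rightarrow> bool" where
  "convex_subgroup H \<longleftrightarrow> 0 \<in> H \<and> (\<forall>x\<in>H. \<forall>y\<in>H. x + y \<in> H) \<and> (\<forall>x\<in>H. - x \<in> H)
     \<and> (\<forall>x\<in>H. \<forall>y. 0 \<le> y \<longrightarrow> y \<le> x \<longrightarrow> y \<in> H)"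

text \<open>For convex \<open>H\<close>: \<open>d\<close> is strictly positive in the quotient by
  \<open>H\<close>.\<close>

definition above :: "'g::linordered_ab_group_add set \<Rightarrow> 'g \<Rightarrow> bool" where
  "above H d \<longleftrightarrow> (\<forall>h\<in>H. h < d)"

lemma convex_subgroupD:
  assumes "convex_subgroup H"
  shows "0 \<in> H" "x \<in> H \<Longrightarrow> y \<in> H \<Longrightarrow> x + y \<in> H" "x \<in> H \<Longrightarrow> - x \<in> H"
    "x \<in> H \<Longrightarrow> 0 \<le> y \<Longrightarrow> y \<le> x \<Longrightarrow> y \<in> H" "x \<in> H \<Longrightarrow> y \<in> H \<Longrightarrow> x - y \<in> H"
proof -
  show add: "x \<in> H \<Longrightarrow> y \<in> H \<Longrightarrow> x + y \<in> H" and minus: "x \<in> H \<Longrightarrow> - x \<in> H" for x y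
    using assms unfolding convex_subgroup_def by simp_all
  show "0 \<in> H" "x \<in> H \<Longrightarrow> 0 \<le> y \<Longrightarrow> y \<le> x \<Longrightarrow> y \<in> H"
    using assms unfolding convex_subgroup_def by (simp, fast)
  show "x \<in> H \<Longrightarrow> y \<in> H \<Longrightarrow> x - y \<in> H"
    using add[of x "- y"] minus[of y] by simp
qed

lemma convex_subgroup_zero: "convex_subgroup {0}"
  by (auto simp: convex_subgroup_def)

lemma above_zero_iff [simp]: "above {0} d \<longleftrightarrow> 0 < d"
  by (auto simp: above_def)

lemma aboveI:
  assumes "convex_subgroup H" "0 \<le> d" "d \<notin> H"
  shows "above H d"
  using assms convex_subgroupD(4)[of H _ d] unfolding above_def by (meson not_le)

lemma above_pos: "convex_subgroup H \<Longrightarrow> above H d \<Longrightarrow> 0 < d"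
  by (auto simp: above_def dest: convex_subgroupD)

lemma above_not_in: "above H d \<Longrightarrow> d \<notin> H"
  by (auto simp: above_def)

lemma above_add:
  assumes "convex_subgroup H" "above H d" "h \<in> H"
  shows "above H (d + h)"
  unfolding above_def
proof
  fix k assume "k \<in> H"
  then have "k - h < d" using assms convex_subgroupD(5)[of H k h] unfolding above_def by blast
  then show "k < d + h" by (simp add: diff_less_eq)
qed

lemma above_mono: "above H d \<Longrightarrow> d \<le> e \<Longrightarrow> above H e"
  unfolding above_def by (meson less_le_trans)

lemma ex_above:
  fixes H :: "'g::linordered_ab_group_add set"
  assumes H: "convex_subgroup H" "H \<noteq> UNIV"
  shows "\<exists>d. above H d"
proof -
  obtain d where d: "d \<notin> H" using H(2) by blast
  then have "- d \<notin> H" using convex_subgroupD(3)[OF H(1), of "- d"] by auto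
  then show ?thesis using d aboveI[OF H(1), of d] aboveI[OF H(1), of "- d"]
    by (metis linear neg_0_le_iff_le)
qed


lemma add_eq_left:
  fixes x x' y y' :: "'g::linordered_ab_group_add"
  assumes "x \<le> x'" "y \<le> y'" "x' + y' = x + y"
  shows "x' = x"
  using add_less_le_mono[of x x' y y'] assms by (metis less_irrefl order.not_eq_order_implies_strict)


section \<open>The lowest and the highest exponent of a leading form\<close>

type_synonym ('m, 'k) quot = "('m \<Rightarrow>\<^sub>0 'k) fract"

text \<open>Exponents are moved to the difference group so that they can be subtracted.
  \<open>lo 0\<close> is the minimum of an empty set and carries no meaning.\<close>

definition lo :: "('m::{ordered_cancel_comm_monoid_add, linorder} \<Rightarrow>\<^sub>0 'k::field) \<Rightarrow> 'm gp" where
  "lo f = Min (gp_of ` Poly_Mapping.keys f)"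

text \<open>
  The exponents of \<open>f\<close> that differ from the lowest one by an element of \<open>H\<close> form the leading form
  of \<open>f\<close> with respect to the valuation with value group \<open>gp M / H\<close>.
\<close>

definition hi :: "'m gp set \<Rightarrow> ('m::{ordered_cancel_comm_monoid_add, linorder} \<Rightarrow>\<^sub>0 'k::field) \<Rightarrow> 'm gp" where
  "hi H f = Max {x \<in> gp_of ` Poly_Mapping.keys f. x - lo f \<in> H}"

text \<open>By cancellation, \<open>\<mu>\<close> and \<open>\<nu>\<close> form the only pair
  contributing to this coefficient, so the convolution sum collapses to one product.\<close>

lemma lookup_mult_unique:
  fixes f g :: "'m::{cancel_ab_semigroup_add, comm_monoid_add} \<Rightarrow>\<^sub>0 'k::field"
  assumes "\<And>a b. a \<in> Poly_Mapping.keys f \<Longrightarrow> b \<in> Poly_Mapping.keys g \<Longrightarrow> a + b = \<mu> + \<nu> \<Longrightarrow> a = \<mu>"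
  shows "Poly_Mapping.lookup (f * g) (\<mu> + \<nu>) = Poly_Mapping.lookup f \<mu> * Poly_Mapping.lookup g \<nu>"
proof -
  have "Poly_Mapping.lookup f l * Sum_any (\<lambda>q. Poly_Mapping.lookup g q when \<mu> + \<nu> = l + q)
     = (Poly_Mapping.lookup f \<mu> * Poly_Mapping.lookup g \<nu> when l = \<mu>)" for l
  proof (cases "l = \<mu>")
    case True
    have "(\<lambda>q. Poly_Mapping.lookup g q when \<mu> + \<nu> = \<mu> + q) = (\<lambda>q. Poly_Mapping.lookup g q when \<nu> = q)"
      by simp
    then show ?thesis using True by simp
  next
    case False
    have "Poly_Mapping.lookup f l = 0 \<or> (\<forall>q. (Poly_Mapping.lookup g q when \<mu> + \<nu> = l + q) = 0)"
      using assms[of l] False by (metis in_keys_iff when_def)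
    then show ?thesis using False by auto
  qed
  then show ?thesis by (simp add: lookup_mult)
qed

lemma lo_le: "a \<in> Poly_Mapping.keys f \<Longrightarrow> lo f \<le> gp_of a"
  unfolding lo_def by (intro Min_le) auto

lemma lo_in: "f \<noteq> 0 \<Longrightarrow> \<exists>a \<in> Poly_Mapping.keys f. lo f = gp_of a"
  unfolding lo_def using Min_in[of "gp_of ` Poly_Mapping.keys f"] by (auto simp del: Min_in)

lemma lo_eqI:
  assumes "a \<in> Poly_Mapping.keys f" "\<And>b. b \<in> Poly_Mapping.keys f \<Longrightarrow> gp_of a \<le> gp_of b"
  shows "lo f = gp_of a"
  using assms unfolding lo_def by (intro Min_eqI) auto

lemma hi_eqI:
  assumes "a \<in> Poly_Mapping.keys f" "gp_of a - lo f \<in> H"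
    "\<And>b. b \<in> Poly_Mapping.keys f \<Longrightarrow> gp_of b - lo f \<in> H \<Longrightarrow> gp_of b \<le> gp_of a"
  shows "hi H f = gp_of a"
  using assms unfolding hi_def by (intro Max_eqI) auto

lemma hi_in:
  assumes "convex_subgroup H" "f \<noteq> 0"
  shows "\<exists>a \<in> Poly_Mapping.keys f. hi H f = gp_of a \<and> gp_of a - lo f \<in> H"
proof -
  let ?S = "{x \<in> gp_of ` Poly_Mapping.keys f. x - lo f \<in> H}"
  obtain a where "a \<in> Poly_Mapping.keys f" "lo f = gp_of a" using lo_in[OF assms(2)] by blast
  then have "gp_of a \<in> ?S" using convex_subgroupD(1)[OF assms(1)] by auto
  then have "Max ?S \<in> ?S" by (intro Max_in) auto
  then show ?thesis unfolding hi_def by auto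
qed

lemma hi_ge: "a \<in> Poly_Mapping.keys f \<Longrightarrow> gp_of a - lo f \<in> H \<Longrightarrow> gp_of a \<le> hi H f"
  unfolding hi_def by (intro Max_ge) auto

lemma hi_minus_lo:
  assumes "convex_subgroup H" "f \<noteq> 0"
  shows "hi H f - lo f \<in> H" "lo f \<le> hi H f"
  using hi_in[OF assms] lo_le[of _ f] by auto

lemma lo_mult:
  fixes f g :: "'m::{ordered_cancel_comm_monoid_add, linorder} \<Rightarrow>\<^sub>0 'k::field"
  assumes "f \<noteq> 0" "g \<noteq> 0"
  shows "lo (f * g) = lo f + lo g"
proof -
  obtain a b where a: "a \<in> Poly_Mapping.keys f" "lo f = gp_of a"
    and b: "b \<in> Poly_Mapping.keys g" "lo g = gp_of b"
    using assms lo_in by metis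
  have "Poly_Mapping.lookup (f * g) (a + b) = Poly_Mapping.lookup f a * Poly_Mapping.lookup g b"
  proof (rule lookup_mult_unique)
    fix a' b' assume *: "a' \<in> Poly_Mapping.keys f" "b' \<in> Poly_Mapping.keys g" "a' + b' = a + b"
    then have "gp_of a \<le> gp_of a'" "gp_of b \<le> gp_of b'" "gp_of a' + gp_of b' = gp_of a + gp_of b"
      using lo_le[OF *(1)] lo_le[OF *(2)] a b by (auto simp: gp_of_add[symmetric])
    then have "gp_of a' = gp_of a" by (rule add_eq_left)
    then show "a' = a" by (simp add: gp_of_eq_iff)
  qed
  then have "a + b \<in> Poly_Mapping.keys (f * g)" using a b by (simp add: in_keys_iff)
  moreover have "gp_of (a + b) \<le> gp_of c" if "c \<in> Poly_Mapping.keys (f * g)" for c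
  proof -
    from that keys_mult obtain a' b' where "a' \<in> Poly_Mapping.keys f" "b' \<in> Poly_Mapping.keys g" "c = a' + b'"
      by fastforce
    then show ?thesis using lo_le[of a' f] lo_le[of b' g] a b by (simp add: gp_of_add add_mono)
  qed
  ultimately have "lo (f * g) = gp_of (a + b)" by (rule lo_eqI)
  then show ?thesis using a b by (simp add: gp_of_add)
qed

text \<open>If a sum of exponents lies in the leading class of the product, both offsets from the
  lowest exponents are nonnegative with sum in \<open>H\<close>, hence in \<open>H\<close> by
  convexity. So the top of that class arises only from the two tops.\<close>

lemma hi_mult:
  fixes f g :: "'m::{ordered_cancel_comm_monoid_add, linorder} \<Rightarrow>\<^sub>0 'k::field"
  assumes H: "convex_subgroup H" and "f \<noteq> 0" "g \<noteq> 0"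
  shows "hi H (f * g) = hi H f + hi H g"
proof -
  obtain a b where a: "a \<in> Poly_Mapping.keys f" "hi H f = gp_of a" "gp_of a - lo f \<in> H"
    and b: "b \<in> Poly_Mapping.keys g" "hi H g = gp_of b" "gp_of b - lo g \<in> H"
    using assms hi_in by metis
  have key: "gp_of a' \<le> gp_of a \<and> gp_of b' \<le> gp_of b"
    if "a' \<in> Poly_Mapping.keys f" "b' \<in> Poly_Mapping.keys g" "(gp_of a' + gp_of b') - (lo f + lo g) \<in> H" for a' b'
  proof -
    have "0 \<le> gp_of a' - lo f" "0 \<le> gp_of b' - lo g" using that lo_le by auto
    moreover have "(gp_of a' - lo f) + (gp_of b' - lo g) \<in> H" using that(3) by (simp add: algebra_simps)
    ultimately have "gp_of a' - lo f \<in> H" "gp_of b' - lo g \<in> H"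
      using convex_subgroupD(4)[OF H] by (metis le_add_same_cancel1 le_add_same_cancel2)+
    then show ?thesis using that a b hi_ge by metis
  qed
  have sum: "(gp_of a + gp_of b) - (lo f + lo g) \<in> H"
    using convex_subgroupD(2)[OF H a(3) b(3)] by (simp add: algebra_simps)
  have "Poly_Mapping.lookup (f * g) (a + b) = Poly_Mapping.lookup f a * Poly_Mapping.lookup g b"
  proof (rule lookup_mult_unique)
    fix a' b' assume *: "a' \<in> Poly_Mapping.keys f" "b' \<in> Poly_Mapping.keys g" "a' + b' = a + b"
    then have eq: "gp_of a' + gp_of b' = gp_of a + gp_of b" by (simp add: gp_of_add[symmetric])
    then have "gp_of a' \<le> gp_of a \<and> gp_of b' \<le> gp_of b" by (intro key[OF *(1,2)]) (simp only: sum)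
    then have "gp_of a = gp_of a'" using eq add_eq_left[of "gp_of a'" "gp_of a" "gp_of b'" "gp_of b"] by simp
    then show "a' = a" by (simp add: gp_of_eq_iff)
  qed
  then have "a + b \<in> Poly_Mapping.keys (f * g)" using a b by (simp add: in_keys_iff)
  moreover have "gp_of c \<le> gp_of (a + b)" 
    if c: "c \<in> Poly_Mapping.keys (f * g)" "gp_of c - lo (f * g) \<in> H" for c
  proof -
    from c(1) keys_mult obtain a' b' where *: "a' \<in> Poly_Mapping.keys f" "b' \<in> Poly_Mapping.keys g" "c = a' + b'"
      by fastforce
    then show ?thesis using key[OF *(1,2)] c(2) lo_mult[OF assms(2,3)] by (simp add: gp_of_add add_mono)
  qed
  ultimately have "hi H (f * g) = gp_of (a + b)"
    using sum lo_mult[OF assms(2,3)] by (intro hi_eqI) (auto simp: gp_of_add)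
  then show ?thesis using a b by (simp add: gp_of_add)
qed

lemma lo_add_ge:
  assumes "f + g \<noteq> 0" "f = 0 \<or> b \<le> lo f" "g = 0 \<or> b \<le> lo g"
  shows "b \<le> lo (f + g)"
proof -
  obtain a where a: "a \<in> Poly_Mapping.keys (f + g)" "lo (f + g) = gp_of a" using lo_in[OF assms(1)] by blast
  then have "a \<in> Poly_Mapping.keys f \<or> a \<in> Poly_Mapping.keys g" using Poly_Mapping.keys_add by fast
  then show ?thesis using lo_le[of a f] lo_le[of a g] a assms by auto
qed

text \<open>All exponents of \<open>g\<close> lie beyond the class \<open>lo f + H\<close>, so
  adding \<open>g\<close> leaves the leading form of \<open>f\<close> alone.\<close>

lemma hi_add:
  fixes f g :: "'m::{ordered_cancel_comm_monoid_add, linorder} \<Rightarrow>\<^sub>0 'k::field"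
  assumes H: "convex_subgroup H" and f: "f \<noteq> 0" and g: "g = 0 \<or> above H (lo g - lo f)"
  shows "f + g \<noteq> 0 \<and> lo (f + g) = lo f \<and> hi H (f + g) = hi H f"
proof (cases "g = 0")
  case False
  with g have g: "above H (lo g - lo f)" by simp
  have far: "b \<notin> Poly_Mapping.keys g" if "gp_of b - lo f \<in> H" for b
  proof
    assume "b \<in> Poly_Mapping.keys g"
    then have "lo g - lo f \<le> gp_of b - lo f" using lo_le by auto
    then show False using above_mono[OF g] above_not_in that by blast
  qed
  have keys: "b \<in> Poly_Mapping.keys (f + g) \<longleftrightarrow> b \<in> Poly_Mapping.keys f" if "gp_of b - lo f \<in> H" for b
    using far[OF that] by (simp add: in_keys_iff lookup_add)
  obtain a where a: "a \<in> Poly_Mapping.keys f" "lo f = gp_of a" using lo_in[OF f] by blast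
  have aH: "gp_of a - lo f \<in> H" using a convex_subgroupD(1)[OF H] by simp
  have pos: "0 < lo g - lo f" using above_pos[OF H g] .
  have afg: "a \<in> Poly_Mapping.keys (f + g)" using keys[OF aH] a by simp
  have "gp_of a \<le> gp_of b" if "b \<in> Poly_Mapping.keys (f + g)" for b
  proof -
    have "b \<in> Poly_Mapping.keys f \<or> b \<in> Poly_Mapping.keys g" using that Poly_Mapping.keys_add by fast
    then show ?thesis using lo_le[of b f] lo_le[of b g] a pos by auto
  qed
  then have lo: "lo (f + g) = lo f" using lo_eqI[OF afg] a by simp
  moreover have "hi H (f + g) = hi H f"
    unfolding hi_def lo using keys by (intro arg_cong[where f = Max]) auto
  ultimately show ?thesis using afg by auto
qed (simp add: f)

lemma gp_of_zero [simp]: "gp_of 0 = 0"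
  by transfer (simp add: diff_rel_def)

lemma lo_single: "c \<noteq> 0 \<Longrightarrow> lo (Poly_Mapping.single a c) = gp_of a"
  by (intro lo_eqI) auto

lemma hi_single: "convex_subgroup H \<Longrightarrow> c \<noteq> 0 \<Longrightarrow> hi H (Poly_Mapping.single a c) = gp_of a"
  by (intro hi_eqI) (auto simp: lo_single convex_subgroupD(1))

section \<open>Valuations on the field of fractions\<close>

text \<open>The homomorphic extension of a multiplicative \<open>w\<close> to fractions;
  multiplicativity makes the choice of representation harmless. The value at \<open>0\<close> is
  unspecified.\<close>

definition fract_ext :: "('a::idom \<Rightarrow> 'g::ab_group_add) \<Rightarrow> 'a fract \<Rightarrow> 'g" where
  "fract_ext w z = (SOME d. \<exists>f g. f \<noteq> 0 \<and> g \<noteq> 0 \<and> z = Fract f g \<and> d = w f - w g)"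

lemma fract_ext_Fract:
  assumes w: "\<And>f g. f \<noteq> 0 \<Longrightarrow> g \<noteq> 0 \<Longrightarrow> w (f * g) = w f + w g" and fg: "f \<noteq> 0" "g \<noteq> 0"
  shows "fract_ext w (Fract f g) = w f - w g"
  unfolding fract_ext_def
proof (rule some_equality)
  show "\<exists>f' g'. f' \<noteq> 0 \<and> g' \<noteq> 0 \<and> Fract f g = Fract f' g' \<and> w f - w g = w f' - w g'"
    using fg by blast
next
  fix d assume "\<exists>f' g'. f' \<noteq> 0 \<and> g' \<noteq> 0 \<and> Fract f g = Fract f' g' \<and> d = w f' - w g'"
  then obtain f' g' where *: "f' \<noteq> 0" "g' \<noteq> 0" "Fract f g = Fract f' g'" "d = w f' - w g'" by blast
  then have "f * g' = f' * g" using fg by (simp add: eq_fract)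
  then have "w f + w g' = w f' + w g" using w[of f g'] w[of f' g] fg * by simp
  then have "w f' - w g' = (w f + w g') - w g - w g'" by simp
  then show "d = w f - w g" using * by simp
qed

lemma fract_cases_nonzero:
  assumes "z \<noteq> 0"
  obtains f g where "z = Fract f g" "f \<noteq> 0" "g \<noteq> 0"
  by (metis assms Zero_fract_def eq_fract(2) eq_fract(3) fract_collapse(1) Fract_cases)

lemma fract_ext_mult:
  assumes w: "\<And>f g. f \<noteq> 0 \<Longrightarrow> g \<noteq> 0 \<Longrightarrow> w (f * g) = w f + w g" and "x \<noteq> 0" "y \<noteq> 0"
  shows "fract_ext w (x * y) = fract_ext w x + fract_ext w y"
proof -
  obtain f g where x: "x = Fract f g" "f \<noteq> 0" "g \<noteq> 0" using assms(2) by (rule fract_cases_nonzero)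
  obtain f' g' where y: "y = Fract f' g'" "f' \<noteq> 0" "g' \<noteq> 0" using assms(3) by (rule fract_cases_nonzero)
  show ?thesis using x y by (simp add: fract_ext_Fract[of w, OF w] w)
qed

definition val :: "('m::{ordered_cancel_comm_monoid_add, linorder}, 'k::field) quot \<Rightarrow> 'm gp" where
  "val = fract_ext lo"

text \<open>A homomorphism on nonzero elements. The difference \<open>hval H x - val x\<close> is
  the spread of the leading form of the numerator minus that of the denominator.\<close>

definition hval :: "'m gp set \<Rightarrow> ('m::{ordered_cancel_comm_monoid_add, linorder}, 'k::field) quot \<Rightarrow> 'm gp" where
  "hval H = fract_ext (hi H)"

lemma val_Fract: "f \<noteq> 0 \<Longrightarrow> g \<noteq> 0 \<Longrightarrow> val (Fract f g) = lo f - lo g"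
  unfolding val_def by (rule fract_ext_Fract) (rule lo_mult)

lemma hval_Fract:
  "convex_subgroup H \<Longrightarrow> f \<noteq> 0 \<Longrightarrow> g \<noteq> 0 \<Longrightarrow> hval H (Fract f g) = hi H f - hi H g"
  unfolding hval_def by (rule fract_ext_Fract) (rule hi_mult)

lemma val_mult: "x \<noteq> 0 \<Longrightarrow> y \<noteq> 0 \<Longrightarrow> val (x * y) = val x + val y"
  unfolding val_def by (rule fract_ext_mult) (rule lo_mult)

lemma hval_mult:
  "convex_subgroup H \<Longrightarrow> x \<noteq> 0 \<Longrightarrow> y \<noteq> 0 \<Longrightarrow> hval H (x * y) = hval H x + hval H y"
  unfolding hval_def by (rule fract_ext_mult) (rule hi_mult)

lemma val_one [simp]: "val 1 = 0"
  using val_mult[of 1 1] by simp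

lemma val_divide:
  assumes "x \<noteq> 0" "y \<noteq> 0"
  shows "val (x / y) = val x - val y"
  using val_mult[of "x / y" y] assms by (simp add: algebra_simps)

lemma hval_divide:
  assumes "convex_subgroup H" "x \<noteq> 0" "y \<noteq> 0"
  shows "hval H (x / y) = hval H x - hval H y"
  using hval_mult[of H "x / y" y] assms by (simp add: algebra_simps)

text \<open>The value of \<open>- 1\<close> is killed by doubling, and ordered groups are
  torsion-free.\<close>

lemma val_minus: "val (- x) = val x"
proof (cases "x = 0")
  case False
  have "val (- 1 :: ('a, 'b) quot) + val (- 1 :: ('a, 'b) quot) = 0"
    using val_mult[of "- 1 :: ('a, 'b) quot" "- 1"] by simp
  then have "val (- 1 :: ('a, 'b) quot) = 0" by simp
  then show ?thesis using val_mult[of "- 1" x] False by simp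
qed simp

lemma common_denominator:
  assumes "x \<noteq> 0"
  obtains f g d where "x = Fract f d" "y = Fract g d" "f \<noteq> 0" "d \<noteq> 0"
proof -
  obtain f g where x: "x = Fract f g" "f \<noteq> 0" "g \<noteq> 0" using assms by (rule fract_cases_nonzero)
  obtain f' g' where y: "y = Fract f' g'" "g' \<noteq> 0" by (cases y)
  show ?thesis
    using that[of "f * g'" "g * g'" "f' * g"] x y by (simp add: eq_fract)
qed

lemma Fract_add_same: "d \<noteq> 0 \<Longrightarrow> Fract f d + Fract g d = Fract (f + g) d"
  by (simp add: eq_fract algebra_simps)

lemma Fract_eq_zero_iff: "d \<noteq> 0 \<Longrightarrow> Fract f d = 0 \<longleftrightarrow> f = 0"
  by (simp add: Zero_fract_def eq_fract)

lemma val_add_ge: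
  assumes "x = 0 \<or> b \<le> val x" "y = 0 \<or> b \<le> val y" "x + y \<noteq> 0"
  shows "b \<le> val (x + y)"
proof (cases "x = 0")
  case False
  then obtain f g d where *: "x = Fract f d" "y = Fract g d" "f \<noteq> 0" "d \<noteq> 0"
    by (rule common_denominator)
  then have sum: "x + y = Fract (f + g) d" by (metis Fract_add_same)
  then have fg: "f + g \<noteq> 0" using assms(3) by (auto simp: fract_collapse)
  have "f = 0 \<or> b + lo d \<le> lo f" using assms(1) * False by (simp add: val_Fract algebra_simps)
  moreover have "g = 0 \<or> b + lo d \<le> lo g"
    using assms(2) * by (cases "g = 0") (simp_all add: val_Fract Fract_eq_zero_iff algebra_simps)
  ultimately have "b + lo d \<le> lo (f + g)" using lo_add_ge[OF fg] by blast
  then show ?thesis using * fg unfolding sum by (simp add: val_Fract algebra_simps)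
qed (use assms in simp)

text \<open>A common denominator shifts both values equally, so the gap required by
  \<open>hi_add\<close> passes to the numerators.\<close>

lemma hval_add:
  assumes H: "convex_subgroup H" and x: "x \<noteq> 0" and y: "y = 0 \<or> above H (val y - val x)"
  shows "x + y \<noteq> 0 \<and> val (x + y) = val x \<and> hval H (x + y) = hval H x"
proof -
  obtain f g d where *: "x = Fract f d" "y = Fract g d" "f \<noteq> 0" "d \<noteq> 0"
    using x by (rule common_denominator)
  have "g = 0 \<or> above H (lo g - lo f)"
    using y * by (cases "g = 0") (simp_all add: val_Fract Fract_eq_zero_iff algebra_simps)
  moreover have "x + y = Fract (f + g) d" using * by (metis Fract_add_same)
  ultimately show ?thesis
    using * hi_add[OF H *(3), of g] by (simp add: val_Fract hval_Fract[OF H] Fract_eq_zero_iff)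
qed

lemma val_add_eq:
  assumes "x \<noteq> 0" "y = 0 \<or> val x < val y"
  shows "x + y \<noteq> 0 \<and> val (x + y) = val x"
  using hval_add[OF convex_subgroup_zero assms(1)] assms(2) by auto

lemma hval_minus_val:
  assumes H: "convex_subgroup H" and "x \<noteq> 0"
  shows "hval H x - val x \<in> H"
proof -
  obtain f g where x: "x = Fract f g" "f \<noteq> 0" "g \<noteq> 0" using assms(2) by (rule fract_cases_nonzero)
  have "(hi H f - lo f) - (hi H g - lo g) \<in> H"
    using hi_minus_lo(1)[OF H] x convex_subgroupD(5)[OF H] by blast
  then show ?thesis using x by (simp add: val_Fract hval_Fract[OF H] algebra_simps)
qed

text \<open>A quotient of two monomials: single-term forms have equal ends, so one element serves
  all \<open>H\<close> at once.\<close>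

lemma ex_val:
  "\<exists>x :: ('m::{ordered_cancel_comm_monoid_add, linorder}, 'k::field) quot. x \<noteq> 0 \<and> val x = \<delta>
     \<and> (\<forall>H. convex_subgroup H \<longrightarrow> hval H x = \<delta>)"
proof -
  obtain a b where d: "\<delta> = gp_of a - gp_of b" using gp_is_difference by blast
  have nz: "Poly_Mapping.single c (1::'k) \<noteq> 0" for c :: 'm
    using lookup_single_eq[of c "1::'k"] by (metis lookup_zero zero_neq_one)
  show ?thesis
    using d nz by (intro exI[of _ "Fract (Poly_Mapping.single a 1) (Poly_Mapping.single b 1)"])
      (simp add: val_Fract hval_Fract lo_single hi_single Fract_eq_zero_iff)
qed

text \<open>The element \<open>t\<^sup>a + t\<^sup>b\<close> with \<open>a - b = h\<close>.\<close>

lemma ex_hval_minus_val: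
  assumes H: "convex_subgroup H" and h: "h \<in> H" "0 < h"
  shows "\<exists>x :: ('m::{ordered_cancel_comm_monoid_add, linorder}, 'k::field) quot.
    x \<noteq> 0 \<and> hval H x = val x + h"
proof -
  obtain a b where d: "h = gp_of a - gp_of b" using gp_is_difference by blast
  let ?f = "Poly_Mapping.single a (1::'k) + Poly_Mapping.single b 1"
  have ab: "gp_of b < gp_of a" "a \<noteq> b" using d h(2) by auto
  then have "Poly_Mapping.lookup ?f c = (if c = a \<or> c = b then 1 else 0)" for c
    by (auto simp: lookup_add lookup_single when_def)
  then have keys: "c \<in> Poly_Mapping.keys ?f \<longleftrightarrow> c = a \<or> c = b" for c
    by (simp add: in_keys_iff)
  have lo: "lo ?f = gp_of b" using ab keys by (intro lo_eqI) auto
  have hi: "hi H ?f = gp_of a" using ab keys d h by (intro hi_eqI) (auto simp: lo)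
  have nz: "?f \<noteq> 0" using keys[of a] by auto
  have "lo (1 :: 'm \<Rightarrow>\<^sub>0 'k) = gp_of 0" "hi H (1 :: 'm \<Rightarrow>\<^sub>0 'k) = gp_of 0"
    using lo_single[of "1::'k" "0::'m"] hi_single[OF H, of "1::'k" "0::'m"] by auto
  then have "Fract ?f 1 \<noteq> 0 \<and> hval H (Fract ?f 1) = val (Fract ?f 1) + h"
    using nz lo hi d by (simp add: val_Fract hval_Fract[OF H] Fract_eq_zero_iff)
  then show ?thesis by blast
qed


section \<open>Polynomials evaluated at points of large value\<close>

text \<open>For \<open>x\<close> of nonnegative value no term falls below the least value of a
  coefficient; the induction follows Horner's scheme.\<close>

lemma poly_val_bound:
  fixes p :: "('m::{ordered_cancel_comm_monoid_add, linorder}, 'k::field) quot poly"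
  shows "\<exists>b. \<forall>x. (x = 0 \<or> 0 \<le> val x) \<longrightarrow> poly p x = 0 \<or> b \<le> val (poly p x)"
proof (induction p)
  case (pCons c p)
  then obtain b where b: "x = 0 \<or> 0 \<le> val x \<Longrightarrow> poly p x = 0 \<or> b \<le> val (poly p x)" for x by blast
  have "poly (pCons c p) x = 0 \<or> min b (val c) \<le> val (poly (pCons c p) x)"
    if x: "x = 0 \<or> 0 \<le> val x" for x
  proof (cases "poly (pCons c p) x = 0")
    case False
    have "x * poly p x = 0 \<or> min b (val c) \<le> val (x * poly p x)"
    proof (cases "x * poly p x = 0")
      case nz: False
      then have "b \<le> val (poly p x)" "0 \<le> val x" using b[OF x] x by auto
      then have "0 + b \<le> val x + val (poly p x)" by (intro add_mono)
      then show ?thesis using nz by (simp add: val_mult min.coboundedI1)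
    qed simp
    then have "min b (val c) \<le> val (c + x * poly p x)"
      using False by (intro val_add_ge) auto
    then show ?thesis by simp
  qed simp
  then show ?case by blast
qed simp

lemma poly_hval_const:
  fixes p :: "('m::{ordered_cancel_comm_monoid_add, linorder}, 'k::field) quot poly"
  assumes H: "convex_subgroup H" and p0: "poly p 0 \<noteq> 0"
  shows "\<exists>N. \<forall>x. x \<noteq> 0 \<longrightarrow> above H (val x - N) \<longrightarrow>
    poly p x \<noteq> 0 \<and> val (poly p x) = val (poly p 0) \<and> hval H (poly p x) = hval H (poly p 0)"
proof (cases p)
  case (pCons c q)
  then have c: "c \<noteq> 0" "poly p 0 = c" using p0 by auto
  obtain b where b: "x = 0 \<or> 0 \<le> val x \<Longrightarrow> poly q x = 0 \<or> b \<le> val (poly q x)" for x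
    using poly_val_bound by blast
  \<comment> \<open>In the bound on \<open>val x\<close>, the \<open>0\<close> makes
    \<open>b\<close> applicable to \<open>q\<close>, and \<open>val c - b\<close> pushes the
    nonconstant part above \<open>c\<close> modulo \<open>H\<close>.\<close>
  have "poly p x \<noteq> 0 \<and> val (poly p x) = val (poly p 0) \<and> hval H (poly p x) = hval H (poly p 0)"
    if x: "x \<noteq> 0" "above H (val x - max 0 (val c - b))" for x
  proof -
    have "0 < val x - max 0 (val c - b)" by (rule above_pos[OF H x(2)])
    then have "0 \<le> val x" by (simp add: le_less_trans less_imp_le)
    then have q: "poly q x = 0 \<or> b \<le> val (poly q x)" using b by blast
    have "x * poly q x = 0 \<or> above H (val (x * poly q x) - val c)"
    proof (cases "poly q x = 0")
      case False
      have "val x - max 0 (val c - b) \<le> val x - (val c - b)" by (intro diff_left_mono) simp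
      also have "\<dots> \<le> val (x * poly q x) - val c" using False q x(1) by (simp add: val_mult algebra_simps)
      finally show ?thesis using above_mono[OF x(2)] by blast
    qed simp
    from hval_add[OF H c(1) this] show ?thesis using pCons c by simp
  qed
  then show ?thesis by blast
qed


section \<open>The localization\<close>

lemma lookup_mult_zero:
  fixes f g :: "'m::{ordered_cancel_comm_monoid_add, linorder} \<Rightarrow>\<^sub>0 'k::field"
  assumes pos: "\<forall>\<alpha>::'m. \<alpha> \<ge> 0"
  shows "Poly_Mapping.lookup (f * g) 0 = Poly_Mapping.lookup f 0 * Poly_Mapping.lookup g 0"
  using lookup_mult_unique[of f g 0 0] pos add_nonneg_eq_0_iff by (metis add.right_neutral)

text \<open>For the converse of \<open>tM_ideal_constant_coeff\<close>, \<open>f\<close> is built up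
  term by term; without constant term, each term is a scalar multiple of a generator.\<close>

lemma tM_ideal_iff:
  fixes f :: "'m::{ordered_cancel_comm_monoid_add, linorder} \<Rightarrow>\<^sub>0 'k::field"
  assumes pos: "\<forall>\<alpha>::'m. \<alpha> \<ge> 0"
  shows "f \<in> tM_ideal \<longleftrightarrow> Poly_Mapping.lookup f 0 = 0"
proof
  let ?R = "ring_of_type_algebra :: ('m \<Rightarrow>\<^sub>0 'k) ring"
  let ?S = "{Poly_Mapping.single \<alpha> 1 | \<alpha>::'m. \<alpha> \<noteq> 0 \<and> \<alpha> \<notin> Units additive_monoid} :: ('m \<Rightarrow>\<^sub>0 'k) set"
  interpret R: cring ?R by (rule cring_from_type_algebra)
  have "?S \<subseteq> carrier ?R" by (simp add: ring_of_type_algebra_def)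
  then have id: "ideal (tM_ideal :: ('m \<Rightarrow>\<^sub>0 'k) set) ?R" "?S \<subseteq> tM_ideal"
    unfolding tM_ideal_def using R.genideal_ideal R.genideal_self by blast+
  interpret I: ideal "tM_ideal :: ('m \<Rightarrow>\<^sub>0 'k) set" ?R by (rule id(1))
  have add: "x + y \<in> (tM_ideal :: ('m \<Rightarrow>\<^sub>0 'k) set)" if "x \<in> tM_ideal" "y \<in> tM_ideal" for x y
    using I.a_closed[OF that] by (simp add: ring_of_type_algebra_def)
  have mult: "x * y \<in> (tM_ideal :: ('m \<Rightarrow>\<^sub>0 'k) set)" if "y \<in> tM_ideal" for x y
    using I.I_l_closed[OF that, of x] by (simp add: ring_of_type_algebra_def)
  have zero: "(0 :: 'm \<Rightarrow>\<^sub>0 'k) \<in> tM_ideal"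
    using I.zero_closed by (simp add: ring_of_type_algebra_def)
  have units: "\<alpha> \<notin> Units additive_monoid" if "\<alpha> \<noteq> 0" for \<alpha> :: 'm
    using that pos add_nonneg_eq_0_iff[of _ \<alpha>] by (auto simp: Units_def additive_monoid_def)
  show "f \<in> tM_ideal" if "Poly_Mapping.lookup f 0 = 0"
    using that
  proof (induction f rule: update_induct)
    case const
    then show ?case using zero by simp
  next
    case (update g a b)
    have g0: "Poly_Mapping.lookup g a = 0" using update.hyps by (simp add: in_keys_iff)
    have eq: "Poly_Mapping.update a b g = g + Poly_Mapping.single a b"
      by (rule poly_mapping_eqI) (auto simp: lookup_update lookup_add lookup_single when_def g0)
    have a: "a \<noteq> 0" using update.prems update.hyps by (auto simp: lookup_update)
    then have "g \<in> tM_ideal" using update by (simp add: lookup_update)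
    moreover have "Poly_Mapping.single a b \<in> tM_ideal"
    proof -
      have "Poly_Mapping.single a 1 \<in> ?S" using a units by blast
      then have "Poly_Mapping.single 0 b * Poly_Mapping.single a 1 \<in> tM_ideal" using id(2) mult by blast
      then show ?thesis by (simp add: mult_single)
    qed
    ultimately show ?case unfolding eq by (rule add)
  qed
qed (rule tM_ideal_constant_coeff[OF pos])

context
  fixes D :: "('m::{ordered_cancel_comm_monoid_add, linorder} \<Rightarrow>\<^sub>0 'k::field) fract set"
  assumes pos: "\<forall>\<alpha>::'m. \<alpha> \<ge> 0" and D_def: "D = tM_localization"
begin

lemma D_iff: "z \<in> D \<longleftrightarrow> (\<exists>f g. z = Fract f g \<and> Poly_Mapping.lookup g 0 \<noteq> 0)"
  unfolding D_def tM_localization_def using tM_ideal_iff[OF pos] by blast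

lemma D_cases:
  assumes "z \<in> D"
  obtains f g where "z = Fract f g" "Poly_Mapping.lookup g 0 \<noteq> 0" "g \<noteq> 0"
  using assms unfolding D_iff by (metis lookup_zero)

lemma D_add: "x \<in> D \<Longrightarrow> y \<in> D \<Longrightarrow> x + y \<in> D"
  by (elim D_cases) (auto simp: D_iff lookup_mult_zero[OF pos] intro!: exI)

lemma D_mult: "x \<in> D \<Longrightarrow> y \<in> D \<Longrightarrow> x * y \<in> D"
  by (elim D_cases) (auto simp: D_iff lookup_mult_zero[OF pos] intro!: exI)

lemma D_minus: "x \<in> D \<Longrightarrow> - x \<in> D"
  by (elim D_cases) (auto simp: D_iff intro!: exI)

lemma D_diff: "x \<in> D \<Longrightarrow> y \<in> D \<Longrightarrow> x - y \<in> D"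
  using D_add[of x "- y"] D_minus[of y] by simp

lemma D_one: "1 \<in> D" and D_zero: "0 \<in> D"
  unfolding D_iff One_fract_def Zero_fract_def by (metis lookup_one_zero zero_neq_one)+

lemma lo_zero:
  fixes g :: "'m \<Rightarrow>\<^sub>0 'k"
  shows "Poly_Mapping.lookup g 0 \<noteq> 0 \<Longrightarrow> lo g = 0"
  using lo_eqI[of 0 g] pos by (simp add: in_keys_iff gp_of_le_iff del: gp_of_zero add: gp_of_zero[symmetric])

text \<open>Denominators in \<open>D\<close> have lowest exponent \<open>0\<close>, so the value is
  the lowest exponent of the numerator.\<close>

lemma val_D:
  assumes "z \<in> D" "z \<noteq> 0"
  shows "\<exists>\<alpha>::'m. val z = gp_of \<alpha>"
proof -
  obtain f g where z: "z = Fract f g" "Poly_Mapping.lookup g 0 \<noteq> 0" "g \<noteq> 0" using assms(1) by (rule D_cases)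
  have f: "f \<noteq> 0" using assms(2) z by (simp add: Fract_eq_zero_iff)
  then show ?thesis using z lo_zero[OF z(2)] lo_in[OF f] by (auto simp: val_Fract)
qed

lemma inverse_D:
  assumes "z \<in> D" "z \<noteq> 0" "val z = 0"
  shows "inverse z \<in> D"
proof -
  obtain f g where z: "z = Fract f g" "Poly_Mapping.lookup g 0 \<noteq> 0" "g \<noteq> 0" using assms(1) by (rule D_cases)
  have f: "f \<noteq> 0" using assms(2) z by (simp add: Fract_eq_zero_iff)
  obtain a where a: "a \<in> Poly_Mapping.keys f" "lo f = gp_of a" using lo_in[OF f] by blast
  have "gp_of a = gp_of 0" using assms(3) z f lo_zero[OF z(2)] a by (simp add: val_Fract)
  then have "a = 0" by (simp only: gp_of_eq_iff)
  then have "Poly_Mapping.lookup f 0 \<noteq> 0" using a by (simp add: in_keys_iff)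
  then show ?thesis unfolding D_iff using z by auto
qed

text \<open>If \<open>H\<close> meets the monoid only in \<open>0\<close>, the leading form of a
  denominator in \<open>D\<close> is its constant term, so only the numerator contributes a
  spread.\<close>

lemma hval_D:
  assumes H: "convex_subgroup H" "\<And>\<alpha>::'m. gp_of \<alpha> \<in> H \<Longrightarrow> \<alpha> = 0" and "z \<in> D" "z \<noteq> 0"
  shows "val z \<le> hval H z"
proof -
  obtain f g where z: "z = Fract f g" "Poly_Mapping.lookup g 0 \<noteq> 0" "g \<noteq> 0" using assms(3) by (rule D_cases)
  have f: "f \<noteq> 0" using assms(4) z by (simp add: Fract_eq_zero_iff)
  have g: "lo g = gp_of 0" using lo_zero[OF z(2)] by simp
  have "hi H g = gp_of 0"
    using z(2) H(1) by (intro hi_eqI) (auto simp: g in_keys_iff convex_subgroupD(1) dest: H(2))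
  then show ?thesis using z f g hi_minus_lo(2)[OF H(1) f] by (simp add: val_Fract hval_Fract[OF H(1)])
qed

end

section \<open>The maximal length of a factorization\<close>

text \<open>\<open>\<l>\<close> is the maximal length of a factorization; concatenating longest
  factorizations gives superadditivity. It is the measure for both later descents.\<close>

lemma bounded_factorization_length:
  assumes pos: "\<forall>\<alpha>::'m::{ordered_cancel_comm_monoid_add, linorder}. \<alpha> \<ge> 0"
    and bf: "bounded_factorization_monoid (additive_monoid :: 'm monoid)"
  shows "\<exists>\<l> :: 'm \<Rightarrow> nat. (\<forall>a b. \<l> a + \<l> b \<le> \<l> (a + b)) \<and> (\<forall>a. a \<noteq> 0 \<longrightarrow> 0 < \<l> a)"
proof -
  have foldr_add: "foldr (+) fs c = sum_list fs + c" for fs and c :: 'm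
    by (induction fs) (simp_all add: add.assoc)
  define L where "L a = {length fs | fs. factors additive_monoid fs (a::'m)}" for a
  \<comment> \<open>Bounded factorization says nothing about the unit \<open>0\<close>, so its
    length is set to \<open>0\<close> directly.\<close>
  define \<l> where "\<l> a = (if a = 0 then 0 else Max (L a))" for a
  have "a \<in> carrier additive_monoid - Units additive_monoid" if "a \<noteq> 0" for a :: 'm
    using that pos add_nonneg_eq_0_iff[of _ a] by (auto simp: Units_def additive_monoid_def)
  then have L: "finite (L a) \<and> L a \<noteq> {}" if "a \<noteq> 0" for a
    using bf that
    by (auto simp: bounded_factorization_monoid_def atomic_monoid_def L_def additive_monoid_def)
  have in_L: "\<l> a \<in> L a" if "a \<noteq> 0" for a
    using L[OF that] that by (simp add: \<l>_def)
  have "0 < \<l> a" if a: "a \<noteq> 0" for a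
  proof -
    obtain fs where "\<l> a = length fs" "factors additive_monoid fs a" using in_L[OF a] by (auto simp: L_def)
    then show ?thesis using a by (cases fs) (auto simp: factors_def additive_monoid_def)
  qed
  moreover have "\<l> a + \<l> b \<le> \<l> (a + b)" for a b
  proof (cases "a = 0 \<or> b = 0")
    case False
    then have ab: "a \<noteq> 0" "b \<noteq> 0" "a + b \<noteq> 0" using pos by (simp_all add: add_nonneg_eq_0_iff)
    obtain fs gs where "\<l> a = length fs" "factors additive_monoid fs a"
      "\<l> b = length gs" "factors additive_monoid gs b"
      using in_L[OF ab(1)] in_L[OF ab(2)] by (auto simp: L_def)
    moreover from this have "factors additive_monoid (fs @ gs) (a + b)"
      by (auto simp: factors_def additive_monoid_def foldr_add)
    ultimately have "\<l> a + \<l> b \<in> L (a + b)" unfolding L_def by (force intro: exI[of _ "fs @ gs"])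
    then show ?thesis using L[OF ab(3)] ab by (simp add: \<l>_def)
  qed (auto simp: \<l>_def)
  ultimately show ?thesis by blast
qed


section \<open>Value groups with a proper convex subgroup\<close>

lemma val_power_pos:
  fixes t :: "('m::{ordered_cancel_comm_monoid_add, linorder}, 'k::field) quot"
  assumes pos: "\<forall>\<alpha>::'m. \<alpha> \<ge> 0" and t: "t \<noteq> 0" "val t = gp_of \<sigma>" "\<sigma> \<noteq> 0"
  shows "\<exists>\<tau>. \<tau> \<noteq> 0 \<and> val (t ^ Suc r) = gp_of \<tau>"
proof (induction r)
  case (Suc r)
  then obtain \<tau> where "\<tau> \<noteq> 0" "val (t ^ Suc r) = gp_of \<tau>" by blast
  then have "val (t ^ Suc (Suc r)) = gp_of (\<sigma> + \<tau>) \<and> \<sigma> + \<tau> \<noteq> 0"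
    using val_mult[of t "t ^ Suc r"] t pos by (simp add: gp_of_add add_nonneg_eq_0_iff)
  then show ?case by blast
qed (use t in auto)

text \<open>Each further factor has \<open>hval H x \<le> val x\<close>, so the deficit
  \<open>h\<close> of the first factor is never made up.\<close>

lemma hval_power_le:
  assumes H: "convex_subgroup H" and x: "x \<noteq> 0" "hval H x + h \<le> val x" and h: "0 \<le> h"
  shows "hval H (x ^ Suc r) + h \<le> val (x ^ Suc r)"
proof (induction r)
  case (Suc r)
  have "hval H x \<le> val x" using x h by (meson add_increasing2 order.trans order_refl add_le_cancel_left le_add_same_cancel1)
  then have "hval H x + (hval H (x ^ Suc r) + h) \<le> val x + val (x ^ Suc r)" using Suc by (rule add_mono)
  then show ?case
    using val_mult[of x "x ^ Suc r"] hval_mult[OF H, of x "x ^ Suc r"] x(1) by (simp add: add.assoc)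
qed (use x in simp)

context
  fixes D :: "('m::{ordered_cancel_comm_monoid_add, linorder} \<Rightarrow>\<^sub>0 'k::field) fract set"
  assumes pos: "\<forall>\<alpha>::'m. \<alpha> \<ge> 0" and D_def: "D = tM_localization"
begin

text \<open>\<open>\<l>\<close> forbids an infinite descent if \<open>H\<close> contains a nonzero
  element of the monoid; otherwise \<open>hval_D\<close> forbids the negative spread produced by a
  suitable quotient \<open>x\<close>.\<close>

lemma int_valued_constant:
  fixes P Q :: "('m, 'k) quot poly" and \<l> :: "'m \<Rightarrow> nat" and H :: "'m gp set"
  assumes len: "\<And>a b. \<l> a + \<l> b \<le> \<l> (a + b)" "\<And>a. a \<noteq> 0 \<Longrightarrow> 0 < \<l> a"
    and H: "convex_subgroup H" "H \<noteq> {0}" "H \<noteq> UNIV"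
    and PQ: "\<And>x. poly Q x \<noteq> 0" "\<And>x. poly P x / poly Q x \<in> D"
  shows "poly P a / poly Q a = poly P 0 / poly Q 0"
proof (rule ccontr)
  assume ne: "poly P a / poly Q a \<noteq> poly P 0 / poly Q 0"
  \<comment> \<open>Up to the factor \<open>Q(0) Q(x)\<close>, this is
    \<open>\<phi>(x) - \<phi>(0)\<close> for \<open>\<phi> = P / Q\<close>. Splitting off its zero
    at \<open>0\<close> leaves \<open>R1\<close> with \<open>R1(0) \<noteq> 0\<close>.\<close>
  define R where "R = smult (poly Q 0) P - smult (poly P 0) Q"
  have "poly R a \<noteq> 0" using ne PQ(1) by (auto simp: R_def field_simps)
  then have "R \<noteq> 0" by auto
  from order_decomp[OF this, of 0] obtain R1 where R1:
    "R = [:- 0, 1:] ^ order 0 R * R1" "\<not> [:- 0, 1:] dvd R1" by blast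
  have "poly R 0 = 0" by (simp add: R_def)
  with \<open>R \<noteq> 0\<close> obtain r where r: "order 0 R = Suc r"
    by (metis order_root not0_implies_Suc)
  have R1_0: "poly R1 0 \<noteq> 0" using R1(2) by (simp add: poly_eq_0_iff_dvd)
  have polyR: "poly R x = x ^ Suc r * poly R1 x" for x
    using arg_cong[OF R1(1), of "\<lambda>p. poly p x"] r by (simp del: power_Suc)
  define y where "y x = poly R1 x / (poly Q 0 * poly Q x)" for x
  have zD: "x ^ Suc r * y x \<in> D" for x
  proof -
    have "x ^ Suc r * y x = poly R x / (poly Q 0 * poly Q x)" by (simp only: polyR y_def times_divide_eq_right)
    also have "\<dots> = poly P x / poly Q x - poly P 0 / poly Q 0"
      using PQ(1)[of x] PQ(1)[of 0] by (simp add: R_def field_simps)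
    finally show ?thesis using D_diff[OF pos D_def PQ(2) PQ(2)] by simp
  qed
  obtain N1 where N1: "\<And>x. x \<noteq> 0 \<Longrightarrow> above H (val x - N1) \<Longrightarrow>
    poly R1 x \<noteq> 0 \<and> val (poly R1 x) = val (poly R1 0) \<and> hval H (poly R1 x) = hval H (poly R1 0)"
    using poly_hval_const[OF H(1) R1_0] by blast
  obtain N2 where N2: "\<And>x. x \<noteq> 0 \<Longrightarrow> above H (val x - N2) \<Longrightarrow>
    poly Q x \<noteq> 0 \<and> val (poly Q x) = val (poly Q 0) \<and> hval H (poly Q x) = hval H (poly Q 0)"
    using poly_hval_const[OF H(1) PQ(1)] by blast
  define N where "N = max N1 N2"
  have y: "y x \<noteq> 0 \<and> val (y x) = val (y 0) \<and> hval H (y x) = hval H (y 0)"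
    if x: "x \<noteq> 0" "above H (val x - N)" for x
  proof -
    have "above H (val x - N1)" "above H (val x - N2)"
      by (rule above_mono[OF x(2)], simp add: N_def)+
    then show ?thesis
      using N1[OF x(1)] N2[OF x(1)] R1_0 PQ(1)
      by (simp add: y_def val_divide hval_divide[OF H(1)] val_mult hval_mult[OF H(1)])
  qed
  \<comment> \<open>Points of value \<open>N + \<omega>\<close> lie in the range where
    \<open>y\<close> is controlled, and changing their value by elements of \<open>H\<close> does
    not leave it.\<close>
  obtain \<omega> where \<omega>: "above H \<omega>" using ex_above[OF H(1,3)] by blast
  show False
  proof (cases "\<exists>\<sigma>. \<sigma> \<noteq> 0 \<and> gp_of \<sigma> \<in> H")
    case True
    then obtain \<sigma> :: 'm where \<sigma>: "\<sigma> \<noteq> 0" "gp_of \<sigma> \<in> H" by blast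
    obtain t :: "('m, 'k) quot" where t: "t \<noteq> 0" "val t = gp_of \<sigma>" using ex_val by blast
    obtain \<tau> where \<tau>: "\<tau> \<noteq> 0" "val (t ^ Suc r) = gp_of \<tau>" using val_power_pos[OF pos t \<sigma>(1)] by blast
    text \<open>Dividing \<open>x\<close> by \<open>t\<close> splits off a summand \<open>\<tau>\<close> from the value, which cannot go on forever.\<close>
    have descent: False if "x \<noteq> 0" "above H (val x - N)" "val (x ^ Suc r * y x) = gp_of b" "\<l> b = n" for x b n
      using that
    proof (induction n arbitrary: x b rule: less_induct)
      case (less n)
      define x' where "x' = x / t"
      have x: "x = x' * t" using t by (simp add: x'_def)
      have x': "x' \<noteq> 0" using less.prems(1) t by (simp add: x'_def)
      have "val x' - N = val x - N + - gp_of \<sigma>" using x x' t by (simp add: val_mult)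
      then have ab: "above H (val x' - N)"
        using above_add[OF H(1) less.prems(2) convex_subgroupD(3)[OF H(1) \<sigma>(2)]] by (simp only:)
      have yx': "y x' \<noteq> 0" "val (y x') = val (y 0)" using y[OF x' ab] by auto
      have yx: "y x \<noteq> 0" "val (y x) = val (y 0)" using y[OF less.prems(1,2)] by auto
      obtain b' where b': "val (x' ^ Suc r * y x') = gp_of b'"
        using val_D[OF pos D_def zD[of x']] x' yx' by auto
      have "x ^ Suc r = x' ^ Suc r * t ^ Suc r" unfolding x by (rule power_mult_distrib)
      then have "gp_of b = val (x' ^ Suc r) + gp_of \<tau> + val (y 0)"
        using less.prems(3) yx x' t \<tau> by (simp add: val_mult del: power_Suc)
      also have "\<dots> = gp_of (b' + \<tau>)"
        using b' yx' x' by (simp add: val_mult gp_of_add del: power_Suc)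
      finally have "b = b' + \<tau>" by (simp add: gp_of_eq_iff)
      then have "\<l> b' < n" using len(1)[of b' \<tau>] len(2)[OF \<tau>(1)] less.prems(4) by simp
      then show False using less.IH[OF _ x' ab b'] by blast
    qed
    obtain x :: "('m, 'k) quot" where x: "x \<noteq> 0" "val x = N + \<omega>" using ex_val by blast
    then have ab: "above H (val x - N)" using \<omega> by simp
    have "x ^ Suc r * y x \<noteq> 0" using x y[OF x(1) ab] by simp
    then show False using descent[OF x(1) ab] val_D[OF pos D_def zD[of x]] by blast
  next
    case False
    obtain h0 where h0: "h0 \<in> H" "0 < h0"
    proof -
      obtain h where "h \<in> H" "h \<noteq> 0" using H(1,2) convex_subgroupD(1) by blast
      then show ?thesis using that[of h] that[of "- h"] convex_subgroupD(3)[OF H(1)]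
        by (metis linorder_neqE neg_0_less_iff_less)
    qed
    have s0: "hval H (y 0) - val (y 0) \<in> H"
      using hval_minus_val[OF H(1), of "y 0"] R1_0 PQ(1) by (simp add: y_def)
    \<comment> \<open>\<open>h\<close> stays in \<open>H\<close> but outweighs any excess of
      \<open>hval H\<close> over \<open>val\<close> at \<open>y 0\<close>.\<close>
    define h where "h = h0 + max 0 (hval H (y 0) - val (y 0))"
    have h: "h \<in> H" "0 < h"
      using h0 s0 convex_subgroupD(1,2)[OF H(1)]
      by (auto simp: h_def max_def add_pos_nonneg)
    have "max 0 (hval H (y 0) - val (y 0)) < h" using h0 by (simp add: h_def)
    then have h_gt: "hval H (y 0) - val (y 0) < h" by (rule le_less_trans[OF max.cobounded2])
    \<comment> \<open>The denominator \<open>w\<close> has spread \<open>h\<close>, so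
      \<open>x = s / w\<close> will have \<open>hval H x = val x - h\<close>; \<open>s\<close>
      adjusts the value to \<open>N + \<omega>\<close>.\<close>
    obtain w :: "('m, 'k) quot" where w: "w \<noteq> 0" "hval H w = val w + h"
      using ex_hval_minus_val[OF H(1) h(1,2)] by blast
    obtain s :: "('m, 'k) quot" where s: "s \<noteq> 0" "val s = N + \<omega> + val w" "hval H s = N + \<omega> + val w"
      using ex_val H(1) by blast
    define x where "x = s / w"
    have x: "x \<noteq> 0" "val x = N + \<omega>" "hval H x + h = val x"
      using w s by (auto simp: x_def val_divide hval_divide[OF H(1)])
    then have ab: "above H (val x - N)" using \<omega> by simp
    have yx: "y x \<noteq> 0" "val (y x) = val (y 0)" "hval H (y x) = hval H (y 0)" using y[OF x(1) ab] by auto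
    have "val (x ^ Suc r * y x) \<le> hval H (x ^ Suc r * y x)"
      using False x yx by (intro hval_D[OF pos D_def H(1) _ zD]) auto
    then have "val (x ^ Suc r) + val (y 0) \<le> hval H (x ^ Suc r) + hval H (y 0)"
      using x yx by (simp add: val_mult hval_mult[OF H(1)] del: power_Suc)
    moreover have "hval H (x ^ Suc r) + h \<le> val (x ^ Suc r)"
      using hval_power_le[OF H(1) x(1)] x(3) h(2) by simp
    ultimately have "hval H (x ^ Suc r) + h + val (y 0) \<le> hval H (x ^ Suc r) + hval H (y 0)"
      by (meson add_right_mono order.trans)
    then have "h + val (y 0) \<le> hval H (y 0)" by (simp add: add.assoc)
    then show False using h_gt by (simp add: diff_less_eq)
  qed
qed

end

section \<open>Densely ordered value groups without proper convex subgroups\<close>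

text \<open>Density is applied between \<open>u\<close> and the least of \<open>v\<close> and the
  points of \<open>E\<close> after \<open>u\<close>.\<close>

lemma dense_avoid:
  fixes u v :: "'g::linorder"
  assumes dense: "\<And>a b :: 'g. a < b \<Longrightarrow> \<exists>c. a < c \<and> c < b" and E: "finite E" and uv: "u < v"
  shows "\<exists>c. u < c \<and> c < v \<and> c \<notin> E"
proof -
  let ?S = "insert v {e \<in> E. u < e}"
  have "u < Min ?S" using E uv by simp
  then obtain c where c: "u < c" "c < Min ?S" using dense by blast
  then have "c < s" if "s \<in> ?S" for s using that E by auto
  then show ?thesis using c(1) by blast
qed

text \<open>
  Away from finitely many values of \<open>x\<close>, the monomials of \<open>p\<close> of least value do not cancel,
  and the value of \<open>p(x)\<close> is a piecewise linear function \<open>T\<close> of the value of \<open>x\<close>.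
\<close>

lemma poly_val_generic:
  fixes p :: "('m::{ordered_cancel_comm_monoid_add, linorder}, 'k::field) quot poly"
  assumes dense: "\<And>a b :: 'm gp. a < b \<Longrightarrow> \<exists>c. a < c \<and> c < b" and p: "p \<noteq> 0"
  shows "\<exists>T E. finite E \<and> mono T
    \<and> (\<forall>x. x \<noteq> 0 \<longrightarrow> val x \<notin> E \<longrightarrow> poly p x \<noteq> 0 \<and> val (poly p x) = T (val x))
    \<and> (\<forall>e>0. \<exists>d>0. \<forall>u v. u \<le> v \<longrightarrow> v \<le> u + d \<longrightarrow> T v \<le> T u + e)"
  using p
proof (induction p)
  case (pCons c p)
  show ?case
  proof (cases "p = 0")
    case True
    then have c: "c \<noteq> 0" using pCons by simp
    have "\<exists>d>0. d \<le> e" if "0 < e" for e :: "'m gp" using that by blast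
    then show ?thesis
      using True c by (intro exI[of _ "\<lambda>_. val c"] exI[of _ "{}"]) (auto simp: mono_def)
  next
    case False
    then obtain T E where E: "finite E" and mono: "mono T"
      and T: "\<And>x. x \<noteq> 0 \<Longrightarrow> val x \<notin> E \<Longrightarrow> poly p x \<noteq> 0 \<and> val (poly p x) = T (val x)"
      and cont: "\<And>e. e > 0 \<Longrightarrow> \<exists>d>0. \<forall>u v. u \<le> v \<longrightarrow> v \<le> u + d \<longrightarrow> T v \<le> T u + e"
      using pCons by metis
    \<comment> \<open>One Horner step: multiplication by \<open>x\<close> adds the value of
      \<open>x\<close>.\<close>
    define T' where "T' u = u + T u" for u
    have mono': "mono T'" using mono by (auto simp: T'_def mono_def add_mono)
    have T': "x * poly p x \<noteq> 0 \<and> val (x * poly p x) = T' (val x)" if "x \<noteq> 0" "val x \<notin> E" for x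
      using T[OF that] that by (simp add: val_mult T'_def)
    have cont': "\<exists>d>0. \<forall>u v. u \<le> v \<longrightarrow> v \<le> u + d \<longrightarrow> T' v \<le> T' u + e" if e: "e > 0" for e
    proof -
      obtain e1 where e1: "0 < e1" "e1 < e" using dense[OF e] by blast
      then obtain d where d: "d > 0" "\<And>u v. u \<le> v \<Longrightarrow> v \<le> u + d \<Longrightarrow> T v \<le> T u + e1" using cont by meson
      have "T' v \<le> T' u + e" if uv: "u \<le> v" "v \<le> u + min d (e - e1)" for u v
      proof -
        have "v \<le> u + d" "v \<le> u + (e - e1)"
          using uv(2) by (meson add_left_mono min.cobounded1 min.cobounded2 order.trans)+
        then have "v + T v \<le> (u + (e - e1)) + (T u + e1)" using d(2)[OF uv(1)] by (intro add_mono) auto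
        then show ?thesis by (simp add: T'_def algebra_simps)
      qed
      moreover have "min d (e - e1) > 0" using d(1) e1 by simp
      ultimately show ?thesis by blast
    qed
    show ?thesis
    proof (cases "c = 0")
      case True
      then show ?thesis using E mono' T' cont' by (intro exI[of _ T'] exI[of _ E]) simp
    next
      case False
      \<comment> \<open>Being strictly increasing, \<open>T'\<close> meets \<open>val c\<close> at
        most once; \<open>u0\<close> is the only new place where cancellation can occur.\<close>
      have strict: "T' u < T' v" if "u < v" for u v
        using that monoD[OF mono, of u v] by (simp add: T'_def add_less_le_mono)
      have "u = v" if "T' u = val c" "T' v = val c" for u v
        using that strict[of u v] strict[of v u] by (metis less_irrefl linorder_neqE)
      then obtain u0 where u0: "\<And>u. T' u = val c \<Longrightarrow> u = u0" by metis
      let ?T = "\<lambda>u. min (val c) (T' u)"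
      have "poly (pCons c p) x \<noteq> 0 \<and> val (poly (pCons c p) x) = ?T (val x)"
        if x: "x \<noteq> 0" "val x \<notin> insert u0 E" for x
      proof -
        have xp: "x * poly p x \<noteq> 0" "val (x * poly p x) = T' (val x)" using T' x by auto
        have "T' (val x) \<noteq> val c" using x u0 by auto
        then consider "T' (val x) < val c" | "val c < T' (val x)" by (meson linorder_neqE)
        then show ?thesis
        proof cases
          case 1
          then show ?thesis using val_add_eq[OF xp(1), of c] xp by (simp add: add.commute)
        next
          case 2
          then show ?thesis using val_add_eq[OF False, of "x * poly p x"] xp by simp
        qed
      qed
      moreover have "mono ?T" using mono' by (simp add: mono_def) (meson min.coboundedI2)
      moreover have "\<exists>d>0. \<forall>u v. u \<le> v \<longrightarrow> v \<le> u + d \<longrightarrow> ?T v \<le> ?T u + e" if e: "e > 0" for e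
      proof -
        obtain d where d: "d > 0" "\<And>u v. u \<le> v \<Longrightarrow> v \<le> u + d \<Longrightarrow> T' v \<le> T' u + e" using cont'[OF e] by meson
        have "?T v \<le> ?T u + e" if "u \<le> v" "v \<le> u + d" for u v
          using d(2)[OF that] e
          by (simp add: min_add_distrib_left min.coboundedI1 min.coboundedI2)
        then show ?thesis using d(1) by blast
      qed
      ultimately show ?thesis using E
        by (intro exI[of _ ?T] exI[of _ "insert u0 E"]) simp
    qed
  qed
qed simp

lemma poly_nonzero_value:
  fixes p :: "('m::{ordered_cancel_comm_monoid_add, linorder}, 'k::field) quot poly"
  assumes dense: "\<And>a b :: 'm gp. a < b \<Longrightarrow> \<exists>c. a < c \<and> c < b" and \<gamma>: "0 < (\<gamma> :: 'm gp)" and p: "p \<noteq> 0"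
  shows "\<exists>x. poly p x \<noteq> 0"
proof -
  obtain E where E: "finite E" "\<And>x. x \<noteq> 0 \<Longrightarrow> val x \<notin> E \<Longrightarrow> poly p x \<noteq> 0"
    using poly_val_generic[OF dense p] by metis
  obtain \<delta> where "\<delta> \<notin> E" using dense_avoid[OF dense E(1) \<gamma>] by blast
  then show ?thesis using E(2) ex_val[of \<delta>] by blast
qed

text \<open>For \<open>z\<close> in \<open>D\<close> this singles out the nonunits of
  \<open>D\<close>. Zero is listed separately because \<open>val 0\<close> is unspecified.\<close>

definition nonunit :: "('m::{ordered_cancel_comm_monoid_add, linorder}, 'k::field) quot \<Rightarrow> bool" where
  "nonunit z \<longleftrightarrow> z = 0 \<or> val z \<noteq> 0"

text \<open>\<open>max h (- h)\<close> is the absolute value of \<open>h\<close>, a length below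
  which no step outside \<open>E\<close> changes \<open>ty\<close>. A step shorter than
  \<open>|x| + |y|\<close> splits into two admissible ones at a point outside
  \<open>E\<close>.\<close>

lemma convex_subgroup_steps:
  fixes ty :: "'g::linordered_ab_group_add \<Rightarrow> bool"
  assumes dense: "\<And>a b :: 'g. a < b \<Longrightarrow> \<exists>c. a < c \<and> c < b" and E: "finite E"
  shows "convex_subgroup
    {h. \<forall>u v. u \<notin> E \<longrightarrow> v \<notin> E \<longrightarrow> u < v \<longrightarrow> v < u + max h (- h) \<longrightarrow> ty u = ty v}"
    (is "convex_subgroup ?H")
proof -
  have H: "h \<in> ?H \<longleftrightarrow> (\<forall>u v. u \<notin> E \<longrightarrow> v \<notin> E \<longrightarrow> u < v \<longrightarrow> v < u + max h (- h) \<longrightarrow> ty u = ty v)" for h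
    by simp
  have sub: "h \<in> ?H" if "k \<in> ?H" "max h (- h) \<le> max k (- k)" for h k
    unfolding H
  proof (intro allI impI)
    fix u v assume *: "u \<notin> E" "v \<notin> E" "u < v" "v < u + max h (- h)"
    then have "v < u + max k (- k)" using that(2) by (meson add_left_mono less_le_trans)
    then show "ty u = ty v" using * that(1) unfolding H by blast
  qed
  have zero: "0 \<in> ?H" by auto
  have nonneg: "0 \<le> max h (- h)" for h :: 'g by (metis linear max.coboundedI1 max.coboundedI2 neg_0_le_iff_le)
  have add: "x + y \<in> ?H" if x: "x \<in> ?H" and y: "y \<in> ?H" for x y
    unfolding H
  proof (intro allI impI)
    fix u v assume uv: "u \<notin> E" "v \<notin> E" "u < v" "v < u + max (x + y) (- (x + y))"
    let ?x = "max x (- x)" and ?y = "max y (- y)"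
    have "x + y \<le> ?x + ?y" "- x + - y \<le> ?x + ?y" by (intro add_mono; simp)+
    then have "max (x + y) (- (x + y)) \<le> ?x + ?y" by (simp add: add.commute)
    then have v: "v < u + (?x + ?y)" using uv(4) by (meson add_left_mono less_le_trans)
    \<comment> \<open>If one absolute value is \<open>0\<close>, the other alone already bounds the
      step; splitting needs both positive.\<close>
    consider "v < u + ?x" | "v < u + ?y" | "?x > 0" "?y > 0"
      using v nonneg[of x] nonneg[of y] by (metis add.left_neutral add.right_neutral order.not_eq_order_implies_strict)
    then show "ty u = ty v"
    proof cases
      case 3
      have "max u (v - ?y) < min v (u + ?x)" 
        using uv(3) v 3 by (simp add: diff_less_eq add.assoc)
      from dense_avoid[OF dense E this] obtain c where c: "max u (v - ?y) < c" "c < min v (u + ?x)" "c \<notin> E" by blast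
      then have "u < c" "c < v" "c < u + ?x" "v < c + ?y" by (auto simp: diff_less_eq)
      then show ?thesis using uv c(3) x y unfolding H by blast
    next
      case 1
      then show ?thesis using uv x unfolding H by blast
    next
      case 2
      then show ?thesis using uv y unfolding H by blast
    qed
  qed
  show ?thesis
    unfolding convex_subgroup_def
  proof (intro conjI ballI allI impI)
    fix x y assume "x \<in> ?H" "0 \<le> y" "y \<le> x"
    moreover from this have "- y \<le> x" by (meson neg_le_0_iff_le order.trans)
    ultimately show "y \<in> ?H" by (intro sub[of x y]) (auto intro: max.coboundedI1)
  next
    fix x assume "x \<in> ?H"
    then show "- x \<in> ?H" by (rule sub) (simp add: max.commute)
  qed (use zero add in \<open>simp_all only:\<close>)
qed

context
  fixes D :: "('m::{ordered_cancel_comm_monoid_add, linorder} \<Rightarrow>\<^sub>0 'k::field) fract set"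
    and \<gamma> :: "'m gp"
  assumes pos: "\<forall>\<alpha>::'m. \<alpha> \<ge> 0" and D_def: "D = tM_localization"
    and \<gamma>: "\<gamma> > 0" "\<And>\<alpha>::'m. \<alpha> \<noteq> 0 \<Longrightarrow> \<gamma> \<le> gp_of \<alpha>"
    and dense: "\<And>a b :: 'm gp. a < b \<Longrightarrow> \<exists>c. a < c \<and> c < b"
begin

lemma nonunit_iff: "z \<in> D \<Longrightarrow> nonunit z \<longleftrightarrow> z = 0 \<or> 0 < val z"
  using val_D[OF pos D_def, of z] \<gamma> pos
  by (metis gp_of_zero less_le_trans less_irrefl nonunit_def)

lemma nonunit_add:
  assumes "x \<in> D" "y \<in> D" "nonunit x" "nonunit y"
  shows "nonunit (x + y)"
proof -
  have xy: "x = 0 \<or> 0 < val x" "y = 0 \<or> 0 < val y" using assms nonunit_iff by auto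
  consider "x = 0" | "y = 0" | "0 < val x" "0 < val y" using xy by blast
  then show ?thesis
  proof cases
    case 3
    then have "min (val x) (val y) \<le> val (x + y)" if "x + y \<noteq> 0"
      using that by (intro val_add_ge) auto
    then have "0 < val (x + y)" if "x + y \<noteq> 0" using that 3 by (meson less_le_trans min_less_iff_conj)
    then show ?thesis unfolding nonunit_def by force
  qed (use assms in simp_all)
qed

lemma nonunit_minus: "nonunit (- x) \<longleftrightarrow> nonunit x"
  by (simp add: nonunit_def val_minus)

text \<open>Values lie in a positive monoid, where a sum vanishes only if both summands do.\<close>

lemma nonunit_mult:
  assumes "x \<in> D" "y \<in> D"
  shows "nonunit (x * y) \<longleftrightarrow> nonunit x \<or> nonunit y"
proof (cases "x = 0 \<or> y = 0")
  case False
  obtain \<alpha> \<beta> :: 'm where "val x = gp_of \<alpha>" "val y = gp_of \<beta>" using val_D[OF pos D_def] assms False by meson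
  then show ?thesis using False pos
    by (auto simp: nonunit_def val_mult gp_of_add[symmetric] gp_of_eq_iff[of _ 0, simplified] add_nonneg_eq_0_iff)
qed (auto simp: nonunit_def)

text \<open>The generic value of \<phi> is \<open>T1 - T2\<close>. Whether it vanishes is unchanged
  by small steps, hence by all steps, as the admissible lengths form a nonzero convex subgroup. One
  \<open>x\<close> of large value links this to \<open>\<phi>(0)\<close>.\<close>

lemma nonunit_generic:
  fixes P Q :: "('m, 'k) quot poly"
  assumes simple: "\<And>H :: 'm gp set. convex_subgroup H \<Longrightarrow> H = {0} \<or> H = UNIV"
    and P: "P \<noteq> 0" and PQ: "\<And>x. poly Q x \<noteq> 0" "\<And>x. poly P x / poly Q x \<in> D"
  shows "\<exists>E. finite E \<and> (\<forall>x. x \<noteq> 0 \<longrightarrow> val x \<notin> E \<longrightarrow>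
    nonunit (poly P x / poly Q x) = nonunit (poly P 0 / poly Q 0))"
proof -
  define \<phi> where "\<phi> x = poly P x / poly Q x" for x
  have "Q \<noteq> 0" using PQ(1)[of 0] by auto
  obtain T1 E1 where E1: "finite E1" and mono1: "mono T1"
    and T1: "\<And>x. x \<noteq> 0 \<Longrightarrow> val x \<notin> E1 \<Longrightarrow> poly P x \<noteq> 0 \<and> val (poly P x) = T1 (val x)"
    and cont1: "\<And>e. e > 0 \<Longrightarrow> \<exists>d>0. \<forall>u v. u \<le> v \<longrightarrow> v \<le> u + d \<longrightarrow> T1 v \<le> T1 u + e"
    using poly_val_generic[OF dense P] by metis
  obtain T2 E2 where E2: "finite E2" and mono2: "mono T2"
    and T2: "\<And>x. x \<noteq> 0 \<Longrightarrow> val x \<notin> E2 \<Longrightarrow> poly Q x \<noteq> 0 \<and> val (poly Q x) = T2 (val x)"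
    and cont2: "\<And>e. e > 0 \<Longrightarrow> \<exists>d>0. \<forall>u v. u \<le> v \<longrightarrow> v \<le> u + d \<longrightarrow> T2 v \<le> T2 u + e"
    using poly_val_generic[OF dense \<open>Q \<noteq> 0\<close>] by metis
  define E where "E = E1 \<union> E2"
  have E: "finite E" using E1 E2 by (simp add: E_def)
  define ty where "ty u \<longleftrightarrow> T1 u = T2 u" for u
  have val_\<phi>: "\<phi> x \<noteq> 0 \<and> val (\<phi> x) = T1 (val x) - T2 (val x)" if "x \<noteq> 0" "val x \<notin> E" for x
    using T1 T2 that by (simp add: E_def \<phi>_def val_divide)
  then have type: "nonunit (\<phi> x) \<longleftrightarrow> \<not> ty (val x)" if "x \<noteq> 0" "val x \<notin> E" for x
    using that by (simp add: nonunit_def ty_def)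
  \<comment> \<open>\<open>T1 u - T2 u\<close> is the value of an element of \<open>D\<close>, hence
    an element of the monoid.\<close>
  have gap: "T1 u = T2 u \<or> \<gamma> \<le> T1 u - T2 u" if u: "u \<notin> E" for u
  proof -
    obtain x :: "('m, 'k) quot" where x: "x \<noteq> 0" "val x = u" using ex_val by blast
    then obtain \<alpha> :: 'm where "val (\<phi> x) = gp_of \<alpha>"
      using val_D[OF pos D_def, of "\<phi> x"] val_\<phi> PQ(2) u unfolding \<phi>_def by blast
    then show ?thesis using val_\<phi>[of x] x u \<gamma>(2)[of \<alpha>] by (cases "\<alpha> = 0") auto
  qed
  \<comment> \<open>Both functions are monotone, so a step moving each by at most \<open>e\<close>
    moves their difference by at most \<open>e < \<gamma>\<close>, too little to cross the
    gap.\<close>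
  obtain e where e: "0 < e" "e < \<gamma>" using dense[OF \<gamma>(1)] by blast
  obtain d1 where d1: "d1 > 0" "\<And>u v. u \<le> v \<Longrightarrow> v \<le> u + d1 \<Longrightarrow> T1 v \<le> T1 u + e" using cont1[OF e(1)] by meson
  obtain d2 where d2: "d2 > 0" "\<And>u v. u \<le> v \<Longrightarrow> v \<le> u + d2 \<Longrightarrow> T2 v \<le> T2 u + e" using cont2[OF e(1)] by meson
  define d where "d = min d1 d2"
  have d: "d > 0" using d1 d2 by (simp add: d_def)
  have step: "ty u = ty v" if uv: "u \<notin> E" "v \<notin> E" "u < v" "v < u + d" for u v
  proof -
    have "u + d \<le> u + d1" "u + d \<le> u + d2" by (simp_all add: d_def)
    then have "v \<le> u + d1" "v \<le> u + d2" using uv by (meson less_imp_le less_le_trans)+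
    then have *: "T1 u \<le> T1 v" "T1 v \<le> T1 u + e" "T2 u \<le> T2 v" "T2 v \<le> T2 u + e"
      using d1(2)[of u v] d2(2)[of u v] monoD[OF mono1, of u v] monoD[OF mono2, of u v] uv(3) by auto
    have "T1 v < T2 v + \<gamma>" if "T1 u = T2 u"
    proof -
      have "T1 v \<le> T2 u + e" using * that by simp
      also have "\<dots> \<le> T2 v + e" using * by simp
      finally show ?thesis using e(2) by (meson add_strict_left_mono le_less_trans)
    qed
    then have 1: "ty v" if "ty u" using gap[OF uv(2)] that by (auto simp: ty_def le_diff_eq add.commute)
    have "T1 u < T2 u + \<gamma>" if "T1 v = T2 v"
    proof -
      have "T1 u \<le> T2 u + e" using * that by (metis order.trans)
      then show ?thesis using e(2) by (meson add_strict_left_mono le_less_trans)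
    qed
    then have "ty u" if "ty v" using gap[OF uv(1)] that by (auto simp: ty_def le_diff_eq add.commute)
    with 1 show ?thesis by blast
  qed
  let ?H = "{h. \<forall>u v. u \<notin> E \<longrightarrow> v \<notin> E \<longrightarrow> u < v \<longrightarrow> v < u + max h (- h) \<longrightarrow> ty u = ty v}"
  have "max d (- d) = d" using d by (intro max_absorb1) (meson less_imp_le neg_le_0_iff_le order.trans)
  then have dH: "d \<in> ?H" using step by simp
  have H: "?H = UNIV"
  proof (rule ccontr)
    assume "?H \<noteq> UNIV"
    then have "?H = {0}" using simple[OF convex_subgroup_steps[OF dense E, of ty]] by blast
    then have "d = 0" using dH by (metis (no_types, lifting) singletonD)
    then show False using d by simp
  qed
  have lt: "ty u = ty v" if uv: "u \<notin> E" "v \<notin> E" "u < v" for u v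
  proof -
    \<comment> \<open>The summand \<open>d\<close> makes the bound on \<open>v\<close>
      strict.\<close>
    have mem: "v - u + d \<in> ?H" unfolding H by simp
    have "v < u + (v - u + d)" using d by simp
    also have "\<dots> \<le> u + max (v - u + d) (- (v - u + d))" by (intro add_left_mono max.cobounded1)
    finally show ?thesis using mem uv by blast
  qed
  have all: "ty u = ty v" if "u \<notin> E" "v \<notin> E" for u v
    using lt[OF that] lt[OF that(2,1)] by (metis linorder_neqE)
  text \<open>For \<open>x\<close> of large value, \<open>\<phi>(x)\<close> is congruent to \<open>\<phi>(0)\<close>.\<close>
  define R where "R = smult (poly Q 0) P - smult (poly P 0) Q"
  have "poly R 0 = 0" by (simp add: R_def)
  then obtain R1 where R1: "R = pCons 0 R1" by (cases R) auto
  obtain b where b: "\<And>x. x = 0 \<or> 0 \<le> val x \<Longrightarrow> poly R1 x = 0 \<or> b \<le> val (poly R1 x)"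
    using poly_val_bound by blast
  obtain N where N: "\<And>x. x \<noteq> 0 \<Longrightarrow> N < val x \<Longrightarrow> val (poly Q x) = val (poly Q 0)"
    using poly_hval_const[OF convex_subgroup_zero PQ(1)[of 0]] by auto
  \<comment> \<open>These bounds make \<open>b\<close> applicable, fix the value of
    \<open>Q(x)\<close>, and force the value of a nonzero \<open>\<phi>(x) - \<phi>(0)\<close> to be
    positive.\<close>
  let ?N = "max (max 0 N) (val (poly Q 0) + val (poly Q 0) - b)"
  have "?N < ?N + d" using d by simp
  from dense_avoid[OF dense E this] obtain u where u: "?N < u" "u \<notin> E" by blast
  obtain x :: "('m, 'k) quot" where x: "x \<noteq> 0" "val x = u" using ex_val by blast
  have z: "\<phi> x - \<phi> 0 = x * poly R1 x / (poly Q x * poly Q 0)"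
    using arg_cong[OF R1, of "\<lambda>p. poly p x"] PQ(1)[of x] PQ(1)[of 0] by (simp add: R_def \<phi>_def field_simps)
  have zD: "\<phi> x - \<phi> 0 \<in> D" using D_diff[OF pos D_def] PQ(2) by (simp add: \<phi>_def)
  have "nonunit (\<phi> x - \<phi> 0)"
  proof (cases "poly R1 x = 0")
    case True
    then show ?thesis unfolding z by (simp add: nonunit_def)
  next
    case False
    have "b \<le> val (poly R1 x)" using b[of x] x u False by auto
    then have "val x + b \<le> val x + val (poly R1 x)" by (rule add_left_mono)
    moreover have "val (poly Q 0) + val (poly Q 0) < val x + b" using u x by (simp add: diff_less_eq)
    ultimately have "0 < val x + val (poly R1 x) - (val (poly Q 0) + val (poly Q 0))"
      by (meson diff_gt_0_iff_gt less_le_trans)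
    also have "\<dots> = val (\<phi> x - \<phi> 0)"
      unfolding z using False x u N[of x] PQ(1) by (simp add: val_divide val_mult)
    finally show ?thesis unfolding nonunit_def by (metis less_irrefl)
  qed
  then have "nonunit (\<phi> x) = nonunit (\<phi> 0)"
    using nonunit_add[of "\<phi> 0" "\<phi> x - \<phi> 0"] nonunit_add[of "\<phi> x" "- (\<phi> x - \<phi> 0)"] zD D_minus[OF pos D_def zD]
      PQ(2) nonunit_minus[of "\<phi> x - \<phi> 0"] by (auto simp: \<phi>_def)
  then have "nonunit (\<phi> x') = nonunit (\<phi> 0)" if "x' \<noteq> 0" "val x' \<notin> E" for x'
    using type[OF that] type[OF x(1)] x u all[OF that(2) u(2)] by simp
  then show ?thesis using E unfolding \<phi>_def by blast
qed

text \<open>Without a proper nonzero convex subgroup, \<open>a\<close> and \<open>b\<close> are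
  compared at one point: if \<open>val x < val (a - b)\<close>, then
  \<open>a + x = b + (x + (a - b))\<close>, and both offsets have value
  \<open>val x\<close>.\<close>

lemma nonunit_everywhere:
  fixes P Q :: "('m, 'k) quot poly" and \<l> :: "'m \<Rightarrow> nat"
  assumes len: "\<And>a b. \<l> a + \<l> b \<le> \<l> (a + b)" "\<And>a. a \<noteq> 0 \<Longrightarrow> 0 < \<l> a"
    and PQ: "\<And>x. poly Q x \<noteq> 0" "\<And>x. poly P x / poly Q x \<in> D"
  shows "nonunit (poly P a / poly Q a) = nonunit (poly P b / poly Q b)"
proof (cases "\<exists>H :: 'm gp set. convex_subgroup H \<and> H \<noteq> {0} \<and> H \<noteq> UNIV")
  case True
  then obtain H :: "'m gp set" where "convex_subgroup H" "H \<noteq> {0}" "H \<noteq> UNIV" by blast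
  then have "poly P a / poly Q a = poly P 0 / poly Q 0" for a
    using int_valued_constant[OF pos D_def, of \<l> H Q P a] len PQ by blast
  then show ?thesis by metis
next
  case False
  then have simple: "H = {0} \<or> H = UNIV" if "convex_subgroup H" for H :: "'m gp set"
    using that by blast
  show ?thesis
  proof (cases "P = 0 \<or> a = b")
    case False
    have ex: "\<exists>E. finite E \<and> (\<forall>x. x \<noteq> 0 \<longrightarrow> val x \<notin> E \<longrightarrow>
      nonunit (poly P (a + x) / poly Q (a + x)) = nonunit (poly P a / poly Q a))" for a
    proof -
      let ?P = "pcompose P [:a, 1:]" and ?Q = "pcompose Q [:a, 1:]"
      have "?P \<noteq> 0" using False pcompose_eq_0[of P "[:a, 1:]"] by auto
      moreover have "poly ?Q x \<noteq> 0" "poly ?P x / poly ?Q x \<in> D" for x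
        using PQ by (simp_all add: poly_pcompose)
      ultimately show ?thesis
        using nonunit_generic[of ?P ?Q] simple by (simp add: poly_pcompose)
    qed
    obtain A where A: "finite A" "\<And>x. x \<noteq> 0 \<Longrightarrow> val x \<notin> A \<Longrightarrow>
      nonunit (poly P (a + x) / poly Q (a + x)) = nonunit (poly P a / poly Q a)" using ex[of a] by blast
    obtain B where B: "finite B" "\<And>x. x \<noteq> 0 \<Longrightarrow> val x \<notin> B \<Longrightarrow>
      nonunit (poly P (b + x) / poly Q (b + x)) = nonunit (poly P b / poly Q b)" using ex[of b] by blast
    \<comment> \<open>\<open>\<gamma>\<close> supplies an interval below \<open>val (a - b)\<close>
      in which to avoid both exceptional sets.\<close>
    have "val (a - b) - \<gamma> < val (a - b)" using \<gamma>(1) by simp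
    from dense_avoid[OF dense _ this, of "A \<union> B"] A(1) B(1)
    obtain u where u: "u < val (a - b)" "u \<notin> A" "u \<notin> B" by auto
    obtain x :: "('m, 'k) quot" where x: "x \<noteq> 0" "val x = u" using ex_val by blast
    have "x + (a - b) \<noteq> 0 \<and> val (x + (a - b)) = u"
      using val_add_eq[OF x(1), of "a - b"] x(2) u(1) by simp
    then have "nonunit (poly P (b + (x + (a - b))) / poly Q (b + (x + (a - b)))) = nonunit (poly P b / poly Q b)"
      using B(2)[of "x + (a - b)"] u by simp
    moreover have "b + (x + (a - b)) = a + x" by simp
    ultimately show ?thesis using A(2)[OF x(1)] x(2) u by simp
  qed auto
qed

end

section \<open>Values of integer-valued rational functions\<close>

lemma has_value_Fract: "poly q a \<noteq> 0 \<Longrightarrow> has_value (Fract p q) a (poly p a / poly q a)"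
  unfolding has_value_def by blast

lemma has_value_const: "has_value (Fract [:c:] 1) a c"
  using has_value_Fract[of 1 a "[:c:]"] by simp

lemma has_value_add:
  assumes "has_value \<phi> a b" "has_value \<psi> a c"
  shows "has_value (\<phi> + \<psi>) a (b + c)"
proof -
  obtain p q r s where *: "\<phi> = Fract p q" "poly q a \<noteq> 0" "b = poly p a / poly q a"
    "\<psi> = Fract r s" "poly s a \<noteq> 0" "c = poly r a / poly s a"
    using assms unfolding has_value_def by blast
  then have "q \<noteq> 0" "s \<noteq> 0" by auto
  then have "\<phi> + \<psi> = Fract (p * s + r * q) (q * s)" using * by simp
  then show ?thesis
    using has_value_Fract[of "q * s" a "p * s + r * q"] * by (simp add: add_frac_eq)
qed

lemma has_value_mult:
  assumes "has_value \<phi> a b" "has_value \<psi> a c"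
  shows "has_value (\<phi> * \<psi>) a (b * c)"
proof -
  obtain p q r s where *: "\<phi> = Fract p q" "poly q a \<noteq> 0" "b = poly p a / poly q a"
    "\<psi> = Fract r s" "poly s a \<noteq> 0" "c = poly r a / poly s a"
    using assms unfolding has_value_def by blast
  then show ?thesis using has_value_Fract[of "q * s" a "p * r"] by simp
qed

lemma has_value_minus: "has_value \<phi> a b \<Longrightarrow> has_value (- \<phi>) a (- b)"
  unfolding has_value_def by (metis minus_fract minus_divide_left poly_minus)

lemma has_value_inverse:
  assumes "has_value \<phi> a b" "b \<noteq> 0"
  shows "has_value (inverse \<phi>) a (inverse b)"
proof -
  obtain p q where *: "\<phi> = Fract p q" "poly q a \<noteq> 0" "b = poly p a / poly q a"
    using assms(1) unfolding has_value_def by blast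
  then show ?thesis using has_value_Fract[of p a q] assms(2) by simp
qed

text \<open>The fraction in \<open>has_value\<close> may vary with the point. One with denominator
  of least degree works everywhere, since a zero of that denominator would give a common linear
  factor to cancel.\<close>

lemma Fract_without_poles:
  assumes "\<And>a. \<exists>b. has_value \<phi> a b"
  shows "\<exists>P Q. \<phi> = Fract P Q \<and> (\<forall>a. poly Q a \<noteq> 0)"
proof -
  obtain P0 Q0 where "\<phi> = Fract P0 Q0" "Q0 \<noteq> 0" by (cases \<phi>)
  then obtain P Q where PQ: "\<phi> = Fract P Q" "Q \<noteq> 0"
    and min: "\<And>P' Q'. \<phi> = Fract P' Q' \<Longrightarrow> Q' \<noteq> 0 \<Longrightarrow> degree Q \<le> degree Q'"
    using ex_has_least_nat[of "\<lambda>(P, Q). \<phi> = Fract P Q \<and> Q \<noteq> 0" "(P0, Q0)" "\<lambda>(P, Q). degree Q"] by auto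
  have "poly Q a \<noteq> 0" for a
  proof
    assume Qa: "poly Q a = 0"
    obtain p q where pq: "\<phi> = Fract p q" "poly q a \<noteq> 0"
      using assms unfolding has_value_def by blast
    then have "q \<noteq> 0" by auto
    then have "P * q = p * Q" using PQ pq by (simp add: eq_fract)
    then have "poly P a * poly q a = poly p a * poly Q a" by (metis poly_mult)
    then have "poly P a = 0" using pq Qa by simp
    then obtain P' Q' where *: "P = [:- a, 1:] * P'" "Q = [:- a, 1:] * Q'"
      using Qa by (auto simp: poly_eq_0_iff_dvd dvd_def)
    then have Q': "Q' \<noteq> 0" using PQ by auto
    have "P * Q' = P' * Q" unfolding * by (simp only: ac_simps)
    then have "\<phi> = Fract P' Q'" using PQ Q' by (simp add: eq_fract)
    then have "degree Q \<le> degree Q'" using min Q' by blast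
    moreover have "degree Q = Suc (degree Q')" unfolding * using Q' by (subst degree_mult_eq) auto
    ultimately show False by simp
  qed
  then show ?thesis using PQ by blast
qed

definition value_at :: "'a::field poly fract \<Rightarrow> 'a \<Rightarrow> 'a" where
  "value_at \<phi> a = (THE b. has_value \<phi> a b)"

lemma value_at_eq: "has_value \<phi> a b \<Longrightarrow> value_at \<phi> a = b"
  unfolding value_at_def using has_value_unique by blast

lemma Int_R_I: "(\<And>a. has_value \<phi> a (f a) \<and> f a \<in> D) \<Longrightarrow> \<phi> \<in> Int_R D"
  unfolding Int_R_def by blast

lemma Int_R_value:
  assumes "\<phi> \<in> Int_R D"
  shows "has_value \<phi> a (value_at \<phi> a)" "value_at \<phi> a \<in> D"
proof -
  obtain b where "b \<in> D" "has_value \<phi> a b" using assms unfolding Int_R_def by blast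
  then show "has_value \<phi> a (value_at \<phi> a)" "value_at \<phi> a \<in> D" by (simp_all add: value_at_eq)
qed

lemma value_at_mult:
  "\<phi> \<in> Int_R D \<Longrightarrow> \<psi> \<in> Int_R D \<Longrightarrow> value_at (\<phi> * \<psi>) a = value_at \<phi> a * value_at \<psi> a"
  by (intro value_at_eq has_value_mult Int_R_value)

lemma value_at_add:
  "\<phi> \<in> Int_R D \<Longrightarrow> \<psi> \<in> Int_R D \<Longrightarrow> value_at (\<phi> + \<psi>) a = value_at \<phi> a + value_at \<psi> a"
  by (intro value_at_eq has_value_add Int_R_value)

lemma value_at_minus: "\<phi> \<in> Int_R D \<Longrightarrow> value_at (- \<phi>) a = - value_at \<phi> a"
  by (intro value_at_eq has_value_minus Int_R_value)

lemma has_value_zero: "has_value 0 a 0" and has_value_one: "has_value 1 a 1"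
  using has_value_const[of 0 a] has_value_const[of 1 a]
  by (simp_all add: Zero_fract_def One_fract_def one_pCons)

lemma subring_of_simps [simp]:
  "carrier (subring_of S) = S" "x \<otimes>\<^bsub>subring_of S\<^esub> y = x * y" "x \<oplus>\<^bsub>subring_of S\<^esub> y = x + y"
  "\<one>\<^bsub>subring_of S\<^esub> = 1" "\<zero>\<^bsub>subring_of S\<^esub> = 0"
  by (simp_all add: subring_of_def ring_of_type_algebra_def)

lemma domain_subring_of:
  fixes S :: "'a::idom set"
  assumes "0 \<in> S" "1 \<in> S" "\<And>x y. x \<in> S \<Longrightarrow> y \<in> S \<Longrightarrow> x + y \<in> S"
    "\<And>x y. x \<in> S \<Longrightarrow> y \<in> S \<Longrightarrow> x * y \<in> S" "\<And>x. x \<in> S \<Longrightarrow> - x \<in> S"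
  shows "domain (subring_of S)"
proof -
  have "cring (subring_of S)"
  proof (rule cringI)
    show "abelian_group (subring_of S)"
    proof (rule abelian_groupI)
      fix x assume "x \<in> carrier (subring_of S)"
      then show "\<exists>y\<in>carrier (subring_of S). y \<oplus>\<^bsub>subring_of S\<^esub> x = \<zero>\<^bsub>subring_of S\<^esub>"
        using assms(5) by (intro bexI[of _ "- x"]) auto
    qed (use assms in \<open>auto simp: add.assoc add.commute\<close>)
    show "Group.comm_monoid (subring_of S)"
      by (rule comm_monoidI) (use assms in \<open>auto simp: mult.assoc mult.commute\<close>)
  qed (simp add: distrib_right)
  then show ?thesis by (intro domain.intro) (auto simp: domain_axioms_def)
qed

lemma factors_append:
  assumes "factors (mult_of (subring_of S)) fs (a::'a::comm_ring_1)" "factors (mult_of (subring_of S)) gs b"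
  shows "factors (mult_of (subring_of S)) (fs @ gs) (a * b)"
proof -
  have "foldr (\<otimes>\<^bsub>subring_of S\<^esub>) xs c = prod_list xs * c" for xs and c :: 'a
    by (induction xs) (simp_all add: mult.assoc)
  then show ?thesis using assms by (auto simp: factors_def)
qed

theorem theorem3p9:
  fixes D :: "('m::{ordered_cancel_comm_monoid_add, linorder} \<Rightarrow>\<^sub>0 'k::field) fract set"
  assumes positive: "\<forall>\<alpha>::'m. \<alpha> \<ge> 0"
    and bounded_factorization: "bounded_factorization_monoid (additive_monoid :: 'm monoid)"
    and bounded_away: "bounded_away_from_0 TYPE('m)"
    and no_minimal_positive:
      "\<not> (\<exists>\<gamma>::'m gp. \<gamma> > 0 \<and> (\<forall>\<delta>::'m gp. \<delta> > 0 \<longrightarrow> \<not> \<delta> < \<gamma>))"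
    and D_def: "D = tM_localization"
  shows "local_ring (subring_of (Int_R D)) \<and> atomic_domain (subring_of (Int_R D))"
proof -
  obtain \<gamma> :: "'m gp" where \<gamma>: "\<gamma> > 0" "\<And>\<alpha>::'m. \<alpha> \<noteq> 0 \<Longrightarrow> \<gamma> \<le> gp_of \<alpha>"
    using bounded_away unfolding bounded_away_from_0_def by blast
  have dense: "\<exists>c. a < c \<and> c < b" if "a < b" for a b :: "'m gp"
  proof -
    have "0 < b - a" using that by simp
    then obtain \<delta> where "0 < \<delta>" "\<delta> < b - a" using no_minimal_positive by blast
    then have "a < a + \<delta> \<and> a + \<delta> < b" by (simp add: less_diff_eq add.commute)
    then show ?thesis by blast
  qed
  obtain \<l> :: "'m \<Rightarrow> nat" where len: "\<And>a b. \<l> a + \<l> b \<le> \<l> (a + b)" "\<And>a. a \<noteq> 0 \<Longrightarrow> 0 < \<l> a"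
    using bounded_factorization_length[OF positive bounded_factorization] by blast
  note ctx = positive D_def \<gamma> dense

  \<comment> \<open>Ring structure and units of \<open>Int_R D\<close>\<close>
  let ?S = "Int_R D"
  let ?R = "subring_of ?S"
  have S: "0 \<in> ?S" "1 \<in> ?S"
    using D_zero[OF positive D_def] D_one[OF positive D_def] has_value_zero has_value_one
    by (auto simp: Int_R_def)
  have S_add: "x + y \<in> ?S" if "x \<in> ?S" "y \<in> ?S" for x y
    using has_value_add[OF Int_R_value(1)[OF that(1)] Int_R_value(1)[OF that(2)]]
      D_add[OF positive D_def Int_R_value(2)[OF that(1)] Int_R_value(2)[OF that(2)]]
    by (intro Int_R_I[where f = "\<lambda>a. value_at x a + value_at y a"] conjI)
  have S_mult: "x * y \<in> ?S" if "x \<in> ?S" "y \<in> ?S" for x y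
    using has_value_mult[OF Int_R_value(1)[OF that(1)] Int_R_value(1)[OF that(2)]]
      D_mult[OF positive D_def Int_R_value(2)[OF that(1)] Int_R_value(2)[OF that(2)]]
    by (intro Int_R_I[where f = "\<lambda>a. value_at x a * value_at y a"] conjI)
  have S_minus: "- x \<in> ?S" if "x \<in> ?S" for x
    using has_value_minus[OF Int_R_value(1)[OF that]] D_minus[OF positive D_def Int_R_value(2)[OF that]]
    by (intro Int_R_I[where f = "\<lambda>a. - value_at x a"] conjI)
  have dom: "domain ?R" using S S_add S_mult S_minus by (rule domain_subring_of)
  interpret R: domain ?R by (rule dom)
  have pts: "nonunit (value_at \<phi> a) = nonunit (value_at \<phi> 0)" if \<phi>: "\<phi> \<in> ?S" for \<phi> a
  proof -
    obtain P Q where PQ: "\<phi> = Fract P Q" "\<And>a. poly Q a \<noteq> 0"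
      using Fract_without_poles[of \<phi>] Int_R_value(1)[OF \<phi>] by blast
    then have v: "value_at \<phi> x = poly P x / poly Q x" for x
      using value_at_eq has_value_Fract by blast
    then have "poly P x / poly Q x \<in> D" for x using Int_R_value(2)[OF \<phi>, of x] by simp
    then show ?thesis using nonunit_everywhere[OF ctx len PQ(2)] unfolding v by blast
  qed
  \<comment> \<open>If \<open>\<phi>(0)\<close> is a unit, all values are, so the reciprocal has no
    poles and takes values in \<open>D\<close>.\<close>
  have inverse: "inverse \<phi> \<in> ?S \<and> \<phi> \<noteq> 0" if \<phi>: "\<phi> \<in> ?S" "\<not> nonunit (value_at \<phi> 0)" for \<phi>
  proof -
    have "\<not> nonunit (value_at \<phi> a)" for a using pts[OF \<phi>(1)] \<phi>(2) by blast
    then have nz: "value_at \<phi> a \<noteq> 0" "val (value_at \<phi> a) = 0" for a by (auto simp: nonunit_def)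
    have "inverse \<phi> \<in> ?S"
      by (rule Int_R_I[where f = "\<lambda>a. inverse (value_at \<phi> a)"])
        (simp add: has_value_inverse[OF Int_R_value(1)[OF \<phi>(1)] nz(1)]
          inverse_D[OF positive D_def Int_R_value(2)[OF \<phi>(1)] nz])
    moreover have "\<phi> \<noteq> 0" using nz(1)[of 0] value_at_eq[OF has_value_zero] by auto
    ultimately show ?thesis by blast
  qed
  have one: "\<not> nonunit (1 :: ('m, 'k) quot)" by (simp add: nonunit_def)
  have value_zero: "value_at 0 a = (0 :: ('m, 'k) quot)" for a by (rule value_at_eq[OF has_value_zero])
  have value_one: "value_at 1 a = (1 :: ('m, 'k) quot)" for a by (rule value_at_eq[OF has_value_one])
  have unit: "\<not> nonunit (value_at \<phi> 0)" if "\<phi> \<in> ?S" "\<psi> \<in> ?S" "\<phi> * \<psi> = 1" for \<phi> \<psi>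
    using value_at_mult[OF that(1,2), of 0] nonunit_mult[OF ctx Int_R_value(2)[OF that(1)] Int_R_value(2)[OF that(2)]]
      one value_one that(3) by metis

  \<comment> \<open>Locality\<close>
  let ?I = "{\<phi> \<in> ?S. nonunit (value_at \<phi> 0)}"
  have idl: "ideal ?I ?R"
  proof (rule idealI)
    show "subgroup ?I (add_monoid ?R)"
    proof (rule R.add.subgroupI)
      have "(0 :: ('m, 'k) quot poly fract) \<in> ?I"
        using S(1) value_zero by (simp add: nonunit_def)
      then show "?I \<noteq> {}" by blast
    next
      fix a assume a: "a \<in> ?I"
      then have "\<ominus>\<^bsub>?R\<^esub> a = - a" using S_minus by (intro R.minus_equality) auto
      then show "\<ominus>\<^bsub>?R\<^esub> a \<in> ?I" using a S_minus by (simp add: value_at_minus[where D = D] nonunit_minus[OF ctx])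
    next
      fix a b assume "a \<in> ?I" "b \<in> ?I"
      then show "a \<oplus>\<^bsub>?R\<^esub> b \<in> ?I"
        using S_add nonunit_add[OF ctx] Int_R_value(2)[where D = D] by (simp add: value_at_add[where D = D])
    qed auto
  next
    fix a x assume "a \<in> ?I" "x \<in> carrier ?R"
    then show "x \<otimes>\<^bsub>?R\<^esub> a \<in> ?I" "a \<otimes>\<^bsub>?R\<^esub> x \<in> ?I"
      using S_mult nonunit_mult[OF ctx Int_R_value(2) Int_R_value(2)] by (simp_all add: value_at_mult[where D = D])
  qed (rule R.ring_axioms)
  \<comment> \<open>A member that is a unit at \<open>0\<close> is invertible. That
    \<open>?I\<close> contains every proper ideal yields both its maximality and uniqueness.\<close>
  have proper: "J \<subseteq> ?I" if J: "ideal J ?R" "J \<noteq> carrier ?R" for J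
  proof
    fix \<phi> assume \<phi>: "\<phi> \<in> J"
    interpret J: ideal J ?R by (rule J(1))
    have \<phi>S: "\<phi> \<in> ?S" using J.a_subset \<phi> by auto
    have "nonunit (value_at \<phi> 0)"
    proof (rule ccontr)
      assume "\<not> nonunit (value_at \<phi> 0)"
      then have inv: "inverse \<phi> \<in> ?S" "\<phi> \<noteq> 0" using inverse[OF \<phi>S] by auto
      then have "1 \<in> J" using J.I_r_closed[OF \<phi>, of "inverse \<phi>"] by simp
      then have "J = carrier ?R" using J.one_imp_carrier by simp
      then show False using J(2) by blast
    qed
    then show "\<phi> \<in> ?I" using \<phi>S by blast
  qed
  have "1 \<notin> ?I" using one value_one by simp
  then have I_ne: "carrier ?R \<noteq> ?I" using S(2) by auto
  have "\<exists>!I. maximalideal I ?R"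
  proof (rule ex1I)
    show "maximalideal ?I ?R"
      using idl I_ne proper by (intro maximalidealI) blast+
    fix J assume "maximalideal J ?R"
    then interpret J: maximalideal J ?R .
    have "J \<subseteq> ?I" using proper[OF J.ideal_axioms] J.I_notcarr by blast
    then have "?I = J \<or> ?I = carrier ?R" using J.I_maximal[OF idl] by auto
    then show "J = ?I" using I_ne by blast
  qed
  then have local: "local_ring ?R" unfolding local_ring_def using R.is_cring by blast

  \<comment> \<open>Atomicity\<close>
  let ?G = "mult_of ?R"
  have units: "\<phi> \<in> Units ?G \<longleftrightarrow> \<not> nonunit (value_at \<phi> 0)" if "\<phi> \<in> ?S" "\<phi> \<noteq> 0" for \<phi>
  proof
    assume "\<phi> \<in> Units ?G"
    then show "\<not> nonunit (value_at \<phi> 0)" using unit by (auto simp: Units_def)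
  next
    assume "\<not> nonunit (value_at \<phi> 0)"
    then show "\<phi> \<in> Units ?G"
      using inverse[OF that(1)] that by (auto simp: Units_def intro!: bexI[of _ "inverse \<phi>"])
  qed
  \<comment> \<open>The point \<open>0\<close> decides unithood, but \<open>\<phi>(0)\<close> may
    vanish; so the length of the value is measured at a fixed \<open>x\<close> with
    \<open>\<phi>(x) \<noteq> 0\<close>.\<close>
  have factor: "\<exists>fs. set fs \<subseteq> carrier ?G \<and> factors ?G fs \<phi>"
    if "\<phi> \<in> ?S" "value_at \<phi> x \<noteq> 0" "nonunit (value_at \<phi> 0)" "val (value_at \<phi> x) = gp_of \<alpha>" "\<l> \<alpha> = n" for \<phi> x \<alpha> n
    using that
  proof (induction n arbitrary: \<phi> \<alpha> rule: less_induct)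
    case (less n)
    have \<phi>: "\<phi> \<noteq> 0" using less.prems(2) value_at_eq[OF has_value_zero] by auto
    have not_unit: "\<phi> \<notin> Units ?G" using units \<phi> less.prems by blast
    show ?case
    proof (cases "Divisibility.irreducible ?G \<phi>")
      case True
      then show ?thesis using \<phi> less.prems(1) by (intro exI[of _ "[\<phi>]"]) (simp add: factors_def)
    next
      case False
      then obtain a where a: "a \<in> ?S" "a \<noteq> 0" "properfactor ?G a \<phi>" "a \<notin> Units ?G"
        using not_unit unfolding Divisibility.irreducible_def by auto
      then obtain b where b: "b \<in> ?S" "b \<noteq> 0" "\<phi> = a * b"
        unfolding properfactor_def factor_def by auto
      \<comment> \<open>Otherwise \<phi> would divide \<open>a\<close>, contrary to \<open>a\<close>
        being a proper factor.\<close>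
      have "b \<notin> Units ?G"
      proof
        assume "b \<in> Units ?G"
        then obtain c where "c \<in> ?S" "c \<noteq> 0" "b * c = 1" by (auto simp: Units_def)
        then have "a = \<phi> * c" using b by (simp add: mult.assoc)
        then have "\<phi> divides\<^bsub>?G\<^esub> a" unfolding factor_def using \<open>c \<in> ?S\<close> \<open>c \<noteq> 0\<close> by auto
        then show False using a(3) unfolding properfactor_def by blast
      qed
      then have non: "nonunit (value_at a 0)" "nonunit (value_at b 0)" using units a b by auto
      have val_eq: "value_at \<phi> x = value_at a x * value_at b x" using value_at_mult a b by blast
      then have nz: "value_at a x \<noteq> 0" "value_at b x \<noteq> 0" using less.prems(2) by auto
      obtain \<beta> \<gamma>' :: 'm where vals: "val (value_at a x) = gp_of \<beta>" "val (value_at b x) = gp_of \<gamma>'"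
        using val_D[OF positive D_def Int_R_value(2)[OF a(1)] nz(1)]
          val_D[OF positive D_def Int_R_value(2)[OF b(1)] nz(2)] by blast
      \<comment> \<open>Moving from \<open>0\<close> to \<open>x\<close> shows that both summands of
        the value are nonzero, so both lengths drop.\<close>
      have "nonunit (value_at a x)" "nonunit (value_at b x)"
        using pts[OF a(1), of x] pts[OF b(1), of x] non by simp_all
      then have "\<beta> \<noteq> 0" "\<gamma>' \<noteq> 0" using nz vals by (auto simp: nonunit_def)
      moreover have "gp_of \<alpha> = gp_of (\<beta> + \<gamma>')"
        using less.prems(4) nz vals by (simp add: val_eq val_mult gp_of_add)
      ultimately have "\<l> \<beta> < n" "\<l> \<gamma>' < n"
        using len(1)[of \<beta> \<gamma>'] len(2)[of \<beta>] len(2)[of \<gamma>'] less.prems(5) by (auto simp: gp_of_eq_iff)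
      then obtain fs gs where "set fs \<subseteq> carrier ?G" "factors ?G fs a" "set gs \<subseteq> carrier ?G" "factors ?G gs b"
        using less.IH[OF _ a(1) nz(1) non(1) vals(1)] less.IH[OF _ b(1) nz(2) non(2) vals(2)] by blast
      then show ?thesis using factors_append[of ?S fs a gs b] b(3) by (intro exI[of _ "fs @ gs"]) simp
    qed
  qed
  have "atomic_monoid ?G"
    unfolding atomic_monoid_def
  proof
    fix \<phi> assume "\<phi> \<in> carrier ?G - Units ?G"
    then have \<phi>: "\<phi> \<in> ?S" "\<phi> \<noteq> 0" "nonunit (value_at \<phi> 0)" using units by auto
    obtain P Q where PQ: "\<phi> = Fract P Q" "\<And>a. poly Q a \<noteq> 0"
      using Fract_without_poles[of \<phi>] Int_R_value(1)[OF \<phi>(1)] by blast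
    have "P \<noteq> 0" using \<phi>(2) PQ by (auto simp: fract_collapse)
    from poly_nonzero_value[OF dense \<gamma>(1) this] obtain x where "poly P x \<noteq> 0" by blast
    then have x: "value_at \<phi> x \<noteq> 0" using PQ value_at_eq[OF has_value_Fract[of Q x P]] by simp
    then obtain \<alpha> :: 'm where "val (value_at \<phi> x) = gp_of \<alpha>"
      using val_D[OF positive D_def Int_R_value(2)[OF \<phi>(1)]] by blast
    then show "\<exists>fs. set fs \<subseteq> carrier ?G \<and> factors ?G fs \<phi>" using factor[OF \<phi>(1) x \<phi>(3)] by blast
  qed
  then show ?thesis using local dom unfolding atomic_domain_def by blast
qed

end
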